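(* Let $G$ be a finitely presented group and let $\mathcal{C}$ be a class of finite-computable subsets of $G$. Then: (1) if $G$ is $\mathcal{C}$-generalized twisted conjugacy separable, then the $\mathcal{C}$-generalized twisted conjugacy problem is decidable; (2) if $G$ is $\mathcal{C}$-generalized Brinkmann's separable, then the $\mathcal{C}$-generalized Brinkmann's problem is decidable; (3) if $G$ is $\mathcal{C}$-generalized Brinkmann's conjugacy separable, then the $\mathcal{C}$-generalized Brinkmann's conjugacy problem is decidable.
   Context: Maps are written on the right. The profinite topology on $G$ has as basis the cosets of finite index subgroups; a subset is separable if it is closed in this topology. A subset $S\subseteq G$ is finite-computable if, given a homomorphism $\theta$ from $G$ to a finite group $F$, the set $S\theta\subseteq F$ can be computed. For $K\subseteq G$ and $\phi\in\mathrm{Aut}(G)$ put $\phi\text{-}\mathrm{TCC}(K)=\{(x^{-1}\phi)sx\mid x\in G,\ s\in K\}$, $\mathcal{O}_\phi(K)=\{s\phi^k\mid s\in K,\ k\in\mathbb{Z}\}$ and $\phi\text{-}\mathrm{BCC}(K)=\{x^{-1}sx\mid x\in G,\ s\in\mathcal{O}_\phi(K)\}$. The group $G$ is $\mathcal{C}$-generalized twisted conjugacy (resp. Brinkmann's, resp. Brinkmann's conjugacy) separable if $\phi\text{-}\mathrm{TCC}(K)$ (resp. $\mathcal{O}_\phi(K)$, resp. $\phi\text{-}\mathrm{BCC}(K)$) is separable for all $K\in\mathcal{C}$ and $\phi\in\mathrm{Aut}(G)$. Decision problems for $G$, each taking as input $K\in\mathcal{C}$, $\phi\in\mathrm{Aut}(G)$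 and $x\in G$. $\mathcal{C}$-generalized twisted conjugacy problem: decide whether there is $z\in G$ with $(z^{-1}\phi)xz\in K$. $\mathcal{C}$-generalized Brinkmann's problem: decide whether there is $k\in\mathbb{Z}$ with $x\phi^k\in K$. $\mathcal{C}$-generalized Brinkmann's conjugacy problem: decide whether there is $k\in\mathbb{Z}$ such that $x\phi^k$ has a conjugate in $K$.
   Formalization: Each input K in C is assumed given by a description from which its elements can be listed algorithmically, uniformly in K; without this the claim fails, e.g. for a separable, finite-computable but not recursively enumerable K in the integers. *)

theory Defs
  imports
    "HOL-Analysis.Abstract_Topology"
    "HOL-Algebra.Coset"
    "HOL-Algebra.Bij"
    "HOL-Library.Nat_Bijection"
begin

section \<open>Partial recursive functions\<close>

text \<open>Kleene's schemes, with argument tuples as lists.  Arities are not enforced: surplus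
  arguments are ignored, which does not change the class of computable functions.\<close>

datatype recf =
    Zero
  | Succ
  | Proj nat
  | Comp recf "recf list"
  | PrimRec recf recf
  | Mu recf

fun run :: "recf \<Rightarrow> nat list \<Rightarrow> nat option" where
  "run Zero xs = Some 0"
| "run Succ xs = (case xs of [] \<Rightarrow> None | x # _ \<Rightarrow> Some (Suc x))"
| "run (Proj i) xs = (if i < length xs then Some (xs ! i) else None)"
| "run (Comp f gs) xs =
     (let ys = map (\<lambda>g. run g xs) gs
      in if None \<in> set ys then None else run f (map the ys))"
| "run (PrimRec f g) xs =
     (case xs of [] \<Rightarrow> None
      | n # zs \<Rightarrow> rec_nat (run f zs) (\<lambda>m r. Option.bind r (\<lambda>y. run g (m # y # zs))) n)"
| "run (Mu f) xs =
     (if \<exists>n. run f (n # xs) = Some 0 \<and> (\<forall>i<n. \<exists>y>0. run f (i # xs) = Some y)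
      then Some (LEAST n. run f (n # xs) = Some 0) else None)"


section \<open>Finite presentations\<close>

text \<open>The letter \<open>(i, False)\<close> stands for the \<open>i\<close>-th generator, \<open>(i, True)\<close> for its inverse.\<close>

type_synonym word = "(nat \<times> bool) list"

definition words :: "nat \<Rightarrow> word set" where
  "words n = {w. \<forall>(i, e) \<in> set w. i < n}"

primrec word_val :: "('a, 'b) monoid_scheme \<Rightarrow> 'a list \<Rightarrow> word \<Rightarrow> 'a" where
  "word_val G gs [] = \<one>\<^bsub>G\<^esub>"
| "word_val G gs (l # w) =
     (if snd l then inv\<^bsub>G\<^esub> (gs ! fst l) else gs ! fst l) \<otimes>\<^bsub>G\<^esub> word_val G gs w"

inductive insertion :: "nat \<Rightarrow> word set \<Rightarrow> word \<Rightarrow> word \<Rightarrow> bool" for n R where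
  "i < n \<Longrightarrow> insertion n R (u @ v) (u @ [(i, e), (i, \<not> e)] @ v)"
| "r \<in> R \<Longrightarrow> insertion n R (u @ v) (u @ r @ v)"

text \<open>\<open>G\<close> is presented by the generators \<open>gs\<close> and the finitely many relators \<open>R\<close>.  The words
  equivalent to the empty word under \<open>insertion\<close> are those representing elements of the normal
  closure of \<open>R\<close> in the free group, so the last conjunct says that this normal closure is the
  kernel of the evaluation map.\<close>

definition finite_presentation ::
  "('a, 'b) monoid_scheme \<Rightarrow> 'a list \<Rightarrow> word set \<Rightarrow> bool" where
  "finite_presentation G gs R \<longleftrightarrow>
     group G \<and> set gs \<subseteq> carrier G \<and> finite R \<and> R \<subseteq> words (length gs) \<and>
     word_val G gs ` words (length gs) = carrier G \<and>
     (\<forall>w \<in> words (length gs).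
        word_val G gs w = \<one>\<^bsub>G\<^esub> \<longleftrightarrow> equivclp (insertion (length gs) R) [] w)"


section \<open>Codes\<close>

definition word_code :: "word \<Rightarrow> nat" where
  "word_code w = list_encode (map (\<lambda>(i, e). 2 * i + (if e then 1 else 0)) w)"

text \<open>Up to isomorphism every finite group is given by a multiplication table on
  \<open>{0, \<dots>, m - 1}\<close> with identity \<open>0\<close>.\<close>

definition table_group :: "nat list list \<Rightarrow> nat monoid" where
  "table_group T = \<lparr>carrier = {..<length T}, mult = (\<lambda>i j. T ! i ! j), one = 0\<rparr>"

definition group_table :: "nat list list \<Rightarrow> bool" where
  "group_table T \<longleftrightarrow> (\<forall>row \<in> set T. length row = length T) \<and> group (table_group T)"

definition table_code :: "nat list list \<Rightarrow> nat" where
  "table_code T = list_encode (map list_encode T)"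

text \<open>An automorphism is given by words for the images of the generators.\<close>

definition represents_auto ::
  "('a, 'b) monoid_scheme \<Rightarrow> 'a list \<Rightarrow> word list \<Rightarrow> ('a \<Rightarrow> 'a) \<Rightarrow> bool" where
  "represents_auto G gs ws \<phi> \<longleftrightarrow>
     \<phi> \<in> auto G \<and> set ws \<subseteq> words (length gs) \<and> map (word_val G gs) ws = map \<phi> gs"

definition tuple_code :: "word list \<Rightarrow> nat" where
  "tuple_code ws = list_encode (map word_code ws)"


section \<open>Classes of subsets as inputs\<close>

text \<open>To be an input of an algorithm, a member of \<open>C\<close> must have finite descriptions: the numbers
  \<open>c \<in> D\<close> are the descriptions, and \<open>c\<close> describes \<open>\<nu> c\<close>.  A description is required to determine
  its set effectively, in the weak sense that the elements can be listed from it: a total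
  procedure outputs at stage \<open>k\<close> either nothing (\<open>0\<close>) or (the successor of the code of) a word.
  Membership in \<open>\<nu> c\<close> need not be decidable, and neither need \<open>D\<close>.

  Computability of the images in finite groups does not imply listability.  Some such convention
  is needed: with the identity automorphism, the generalized Brinkmann's problem is
  the membership problem for the sets in \<open>C\<close>.\<close>

definition effective_coding ::
  "('a, 'b) monoid_scheme \<Rightarrow> 'a list \<Rightarrow> nat set \<Rightarrow> (nat \<Rightarrow> 'a set) \<Rightarrow> 'a set set \<Rightarrow> bool" where
  "effective_coding G gs D \<nu> C \<longleftrightarrow>
     \<nu> ` D = C \<and>
     (\<exists>p. \<forall>c \<in> D.
        (\<forall>k. run p [c, k] = Some 0 \<or>
             (\<exists>w \<in> words (length gs). run p [c, k] = Some (Suc (word_code w)))) \<and>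
        \<nu> c = {word_val G gs w | w k.
                 w \<in> words (length gs) \<and> run p [c, k] = Some (Suc (word_code w))})"

text \<open>One algorithm for the whole class, as \<open>K\<close> is an input.  A homomorphism \<open>\<theta>\<close> to a finite group
  is given by a multiplication table and the images of the generators; the output is the finite
  set \<open>\<theta> ` \<nu> c\<close>.\<close>

definition finite_computable_class ::
  "('a, 'b) monoid_scheme \<Rightarrow> 'a list \<Rightarrow> nat set \<Rightarrow> (nat \<Rightarrow> 'a set) \<Rightarrow> bool" where
  "finite_computable_class G gs D \<nu> \<longleftrightarrow>
     (\<exists>p. \<forall>c \<in> D. \<forall>T \<theta>. group_table T \<and> \<theta> \<in> hom G (table_group T) \<longrightarrow>
        run p [c, table_code T, list_encode (map \<theta> gs)] = Some (set_encode (\<theta> ` \<nu> c)))"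


section \<open>Separability\<close>

definition profinite_topology :: "('a, 'b) monoid_scheme \<Rightarrow> 'a topology" where
  "profinite_topology G =
     topology_generated_by (\<Union>H \<in> {H. subgroup H G \<and> finite (rcosets\<^bsub>G\<^esub> H)}. rcosets\<^bsub>G\<^esub> H)"

definition separable :: "('a, 'b) monoid_scheme \<Rightarrow> 'a set \<Rightarrow> bool" where
  "separable G S \<longleftrightarrow> closedin (profinite_topology G) S"

definition TCC :: "('a, 'b) monoid_scheme \<Rightarrow> ('a \<Rightarrow> 'a) \<Rightarrow> 'a set \<Rightarrow> 'a set" where
  "TCC G \<phi> K = {\<phi> (inv\<^bsub>G\<^esub> x) \<otimes>\<^bsub>G\<^esub> s \<otimes>\<^bsub>G\<^esub> x | x s. x \<in> carrier G \<and> s \<in> K}"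

definition auto_orbit :: "('a, 'b) monoid_scheme \<Rightarrow> ('a \<Rightarrow> 'a) \<Rightarrow> 'a set \<Rightarrow> 'a set" where
  "auto_orbit G \<phi> K = {(\<phi> [^]\<^bsub>AutoGroup G\<^esub> k) s | s k. s \<in> K \<and> k \<in> (UNIV :: int set)}"

definition BCC :: "('a, 'b) monoid_scheme \<Rightarrow> ('a \<Rightarrow> 'a) \<Rightarrow> 'a set \<Rightarrow> 'a set" where
  "BCC G \<phi> K = {inv\<^bsub>G\<^esub> x \<otimes>\<^bsub>G\<^esub> s \<otimes>\<^bsub>G\<^esub> x | x s. x \<in> carrier G \<and> s \<in> auto_orbit G \<phi> K}"

definition twisted_conjugacy_separable :: "('a, 'b) monoid_scheme \<Rightarrow> 'a set set \<Rightarrow> bool" where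
  "twisted_conjugacy_separable G C \<longleftrightarrow> (\<forall>K \<in> C. \<forall>\<phi> \<in> auto G. separable G (TCC G \<phi> K))"

definition Brinkmann_separable :: "('a, 'b) monoid_scheme \<Rightarrow> 'a set set \<Rightarrow> bool" where
  "Brinkmann_separable G C \<longleftrightarrow> (\<forall>K \<in> C. \<forall>\<phi> \<in> auto G. separable G (auto_orbit G \<phi> K))"

definition Brinkmann_conjugacy_separable :: "('a, 'b) monoid_scheme \<Rightarrow> 'a set set \<Rightarrow> bool" where
  "Brinkmann_conjugacy_separable G C \<longleftrightarrow> (\<forall>K \<in> C. \<forall>\<phi> \<in> auto G. separable G (BCC G \<phi> K))"


section \<open>Decision problems\<close>

text \<open>The question \<open>Q K \<phi> x\<close> is decidable: one algorithm answers it (1 for yes, 0 for no) on all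
  valid inputs.  Nothing is required on inputs that do not code an instance.\<close>

definition decidable_problem ::
  "('a, 'b) monoid_scheme \<Rightarrow> 'a list \<Rightarrow> nat set \<Rightarrow> (nat \<Rightarrow> 'a set) \<Rightarrow>
   ('a set \<Rightarrow> ('a \<Rightarrow> 'a) \<Rightarrow> 'a \<Rightarrow> bool) \<Rightarrow> bool" where
  "decidable_problem G gs D \<nu> Q \<longleftrightarrow>
     (\<exists>p. \<forall>c \<in> D. \<forall>ws \<phi>. represents_auto G gs ws \<phi> \<longrightarrow>
        (\<forall>w \<in> words (length gs).
           run p [c, tuple_code ws, word_code w] =
             Some (if Q (\<nu> c) \<phi> (word_val G gs w) then 1 else 0)))"

definition twisted_conjugacy_problem_decidable ::
  "('a, 'b) monoid_scheme \<Rightarrow> 'a list \<Rightarrow> nat set \<Rightarrow> (nat \<Rightarrow> 'a set) \<Rightarrow> bool" where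
  "twisted_conjugacy_problem_decidable G gs D \<nu> \<longleftrightarrow>
     decidable_problem G gs D \<nu>
       (\<lambda>K \<phi> x. \<exists>z \<in> carrier G. \<phi> (inv\<^bsub>G\<^esub> z) \<otimes>\<^bsub>G\<^esub> x \<otimes>\<^bsub>G\<^esub> z \<in> K)"

definition Brinkmann_problem_decidable ::
  "('a, 'b) monoid_scheme \<Rightarrow> 'a list \<Rightarrow> nat set \<Rightarrow> (nat \<Rightarrow> 'a set) \<Rightarrow> bool" where
  "Brinkmann_problem_decidable G gs D \<nu> \<longleftrightarrow>
     decidable_problem G gs D \<nu> (\<lambda>K \<phi> x. \<exists>k::int. (\<phi> [^]\<^bsub>AutoGroup G\<^esub> k) x \<in> K)"

definition Brinkmann_conjugacy_problem_decidable ::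
  "('a, 'b) monoid_scheme \<Rightarrow> 'a list \<Rightarrow> nat set \<Rightarrow> (nat \<Rightarrow> 'a set) \<Rightarrow> bool" where
  "Brinkmann_conjugacy_problem_decidable G gs D \<nu> \<longleftrightarrow>
     decidable_problem G gs D \<nu>
       (\<lambda>K \<phi> x. \<exists>k::int. \<exists>z \<in> carrier G.
          inv\<^bsub>G\<^esub> z \<otimes>\<^bsub>G\<^esub> (\<phi> [^]\<^bsub>AutoGroup G\<^esub> k) x \<otimes>\<^bsub>G\<^esub> z \<in> K)"

end

theory Submission
  imports Defs "HOL-Library.More_List"
begin

text \<open>
  All three problems ask whether an element \<open>x\<close> lies in the saturation \<open>S\<close> of \<open>K\<close> under an equivalence
  relation that is generated by moves: applications of \<open>\<phi>\<close>, conjugations, or conjugations twisted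
  by \<open>\<phi>\<close>.  The sets \<^const>\<open>TCC\<close>, \<^const>\<open>auto_orbit\<close> and \<^const>\<open>BCC\<close> are these saturations
  (\<open>TCC_saturation\<close>, \<open>auto_orbit_saturation\<close>, \<open>BCC_saturation\<close>), so one argument serves for all:
  two searches run in parallel, one for a positive and one for a negative answer.

  The positive search uses that \<open>K\<close> can be listed and that equality in a finitely presented group is
  semidecidable.  It looks for a listed word that is reached from the given word by moves, carried out
  on words, and by insertions of relators (\<open>equivclp_word_move\<close>).

  The negative search looks for a finite quotient in which the image of \<open>x\<close> is visibly separated from
  the image of \<open>K\<close> by a set that is invariant under the induced moves (\<open>refutation\<close>).  The image of
  \<open>K\<close> is available because \<open>K\<close> is finite-computable, and everything else is a check of finite
  tables.  Such a set excludes \<open>x\<close> from \<open>S\<close> (\<open>refutation_sound\<close>).  Conversely, if \<open>S\<close> is separable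
  and \<open>x\<close> lies outside \<open>S\<close>, then some coset of a finite-index subgroup separates them.  As \<open>G\<close> is
  finitely generated, it has only finitely many homomorphisms to a given finite group; the common
  kernel of those into the symmetric group of the coset space has finite index and is respected by
  \<open>\<phi>\<close>, so \<open>\<phi>\<close> acts on the quotient and the separation can be observed there
  (\<open>separating_finite_quotient\<close>, \<open>refutation_complete\<close>).

  To obtain an actual program, total computable functions are developed on types with a bijective
  coding by numbers, and semidecidable predicates are those of the form ``there is a number passing a
  decidable test''.  The graph of every partial recursive function is semidecidable
  (\<open>semidecidable_run_graph\<close>), which makes the given procedures usable inside a search even though
  they are reliable on valid inputs only, and two complementary searches are merged into a decision
  procedure (\<open>decide_by_complementary_searches\<close>).
\<close>

section \<open>Total computable functions on coded data\<close>

text \<open>The coding is required to be onto, so that every number is the code of a value.  A search over all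
  values of a type is then a search over all numbers, and decoding costs nothing.\<close>

class coded =
  fixes enc :: "'a \<Rightarrow> nat"
  assumes bij_enc: "bij enc"

instantiation nat :: coded
begin
definition enc_nat :: "nat \<Rightarrow> nat" where [simp]: "enc_nat n = n"
instance by standard (simp add: bij_def inj_on_def surj_def)
end

instantiation prod :: (coded, coded) coded
begin
definition enc_prod :: "'a \<times> 'b \<Rightarrow> nat" where
  "enc_prod u = prod_encode (enc (fst u), enc (snd u))"
instance
proof
  have "enc = prod_encode \<circ> map_prod (enc :: 'a \<Rightarrow> nat) (enc :: 'b \<Rightarrow> nat)"
    by (auto simp: enc_prod_def)
  moreover have "bij (map_prod (enc :: 'a \<Rightarrow> nat) (enc :: 'b \<Rightarrow> nat))"
    using bij_enc[where 'a='a] bij_enc[where 'a='b] by (simp add: bij_def prod.inj_map map_prod_surj)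
  ultimately show "bij (enc :: 'a \<times> 'b \<Rightarrow> nat)"
    using bij_prod_encode by (metis bij_comp)
qed
end

instantiation list :: (coded) coded
begin
definition enc_list :: "'a list \<Rightarrow> nat" where
  "enc_list xs = list_encode (map enc xs)"
instance
proof
  have "enc = list_encode \<circ> map (enc :: 'a \<Rightarrow> nat)"
    by (auto simp: enc_list_def)
  moreover have "bij (map (enc :: 'a \<Rightarrow> nat))"
    using bij_enc[where 'a='a] inj_mapI lists_image[of "enc :: 'a \<Rightarrow> nat" UNIV]
    by (auto simp: bij_def lists_UNIV)
  ultimately show "bij (enc :: 'a list \<Rightarrow> nat)"
    using bij_list_encode by (metis bij_comp)
qed
end

definition dec :: "nat \<Rightarrow> 'a::coded" where "dec = inv_into UNIV enc"

lemma dec_enc [simp]: "dec (enc x) = x"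
  by (simp add: dec_def inv_f_f[OF bij_is_inj[OF bij_enc]])

lemma enc_dec [simp]: "enc (dec n :: 'a::coded) = n"
  by (simp add: dec_def surj_f_inv_f[OF bij_is_surj[OF bij_enc]])

lemma enc_eq_iff [simp]: "enc x = enc y \<longleftrightarrow> x = y"
  by (metis dec_enc)

lemma enc_Pair: "enc (x, y) = prod_encode (enc x, enc y)"
  by (simp add: enc_prod_def)

lemma enc_Nil: "enc [] = 0"
  by (simp add: enc_list_def)

lemma enc_Cons: "enc (x # xs) = Suc (enc (x, xs))"
  by (simp add: enc_list_def enc_prod_def)

definition computable :: "('a::coded \<Rightarrow> 'b::coded) \<Rightarrow> bool" where
  "computable f \<longleftrightarrow> (\<exists>p. \<forall>x. run p [enc x] = Some (enc (f x)))"

subsection \<open>Pairing and unpairing\<close>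

lemma run_PrimRec:
  assumes "run f zs = Some a" "\<And>m y. run g (m # y # zs) = Some (h m y)"
  shows "run (PrimRec f g) (n # zs) = Some (rec_nat a h n)"
proof (induction n)
  case (Suc n)
  then show ?case by (simp add: assms)
qed (simp add: assms)

lemma run_Comp:
  assumes "list_all2 (\<lambda>g y. run g xs = Some y) gs ys"
  shows "run (Comp f gs) xs = run f ys"
proof -
  have "map (\<lambda>g. run g xs) gs = map Some ys"
    using assms by (induction rule: list_all2_induct) auto
  then show ?thesis by (auto simp: Let_def comp_def)
qed

lemma run_Comp_1: "run g xs = Some y \<Longrightarrow> run (Comp f [g]) xs = run f [y]"
  by (rule run_Comp) simp

lemma run_Comp_2:
  "run g xs = Some y \<Longrightarrow> run h xs = Some z \<Longrightarrow> run (Comp f [g, h]) xs = run f [y, z]"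
  by (rule run_Comp) simp

definition add_prog :: recf where "add_prog = PrimRec (Proj 0) (Comp Succ [Proj 1])"

lemma run_add_prog: "run add_prog [x, y] = Some (x + y)"
proof -
  have "run add_prog [x, y] = Some (rec_nat y (\<lambda>_. Suc) x)"
    unfolding add_prog_def by (rule run_PrimRec) simp_all
  also have "rec_nat y (\<lambda>_. Suc) x = x + y" by (induction x) simp_all
  finally show ?thesis .
qed

definition pred_prog :: recf where "pred_prog = PrimRec Zero (Proj 0)"

lemma run_pred_prog: "run pred_prog [x] = Some (x - 1)"
proof -
  have "run pred_prog [x] = Some (rec_nat 0 (\<lambda>m _. m) x)"
    unfolding pred_prog_def by (rule run_PrimRec) simp_all
  then show ?thesis by (cases x) simp_all
qed

definition sub_prog :: recf where
  "sub_prog = Comp (PrimRec (Proj 0) (Comp pred_prog [Proj 1])) [Proj 1, Proj 0]"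

lemma run_sub_prog: "run sub_prog [x, y] = Some (x - y)"
proof -
  have "run (PrimRec (Proj 0) (Comp pred_prog [Proj 1])) [y, x] = Some (rec_nat x (\<lambda>_ r. r - 1) y)"
    by (rule run_PrimRec) (simp_all add: run_pred_prog)
  also have "rec_nat x (\<lambda>_ r. r - 1) y = x - y" by (induction y) simp_all
  finally show ?thesis unfolding sub_prog_def by (subst run_Comp_2) simp_all
qed

definition triangle_prog :: recf where
  "triangle_prog = PrimRec Zero (Comp Succ [Comp add_prog [Proj 0, Proj 1]])"

lemma run_triangle_prog: "run triangle_prog [x] = Some (triangle x)"
proof -
  have "run triangle_prog [x] = Some (rec_nat 0 (\<lambda>m r. Suc (m + r)) x)"
    unfolding triangle_prog_def by (rule run_PrimRec) (simp_all add: run_add_prog)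
  also have "rec_nat 0 (\<lambda>m r. Suc (m + r)) x = triangle x" by (induction x) simp_all
  finally show ?thesis .
qed

definition pair_prog :: recf where
  "pair_prog = Comp add_prog [Comp triangle_prog [add_prog], Proj 0]"

lemma run_pair_prog: "run pair_prog [x, y] = Some (prod_encode (x, y))"
  unfolding pair_prog_def
  by (subst run_Comp_2, subst run_Comp_1) (simp_all add: run_add_prog run_triangle_prog prod_encode_def)

text \<open>The number \<open>m + n\<close> of the antidiagonal on which the code of \<open>(m, n)\<close> lies.  Both components are
  recovered from it by truncated subtraction.  The recursion passes to the next antidiagonal exactly
  when \<open>Suc m\<close> reaches the next triangular number; the factor \<open>1 - (\<dots>)\<close> is the indicator of
  that event.\<close>

definition diagonal :: "nat \<Rightarrow> nat" where
  "diagonal = rec_nat 0 (\<lambda>m d. d + (1 - (triangle (Suc d) - Suc m)))"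

lemma diagonal_bounds: "triangle (diagonal z) \<le> z \<and> z < triangle (Suc (diagonal z))"
proof (induction z)
  case (Suc z)
  have "diagonal (Suc z) = (if triangle (Suc (diagonal z)) \<le> Suc z then Suc (diagonal z) else diagonal z)"
    by (simp add: diagonal_def del: triangle_Suc)
  with Suc show ?case by auto
qed (simp add: diagonal_def)

lemma triangle_mono: "m \<le> n \<Longrightarrow> triangle m \<le> triangle n"
  by (induction rule: dec_induct) auto

lemma diagonal_prod_encode: "diagonal (prod_encode (a, b)) = a + b"
proof -
  let ?z = "prod_encode (a, b)"
  have "triangle (a + b) \<le> ?z" "?z < triangle (Suc (a + b))"
    by (simp_all add: prod_encode_def)
  with diagonal_bounds[of ?z] show ?thesis
    by (metis leD le_less_trans not_less_eq_eq triangle_mono le_antisym)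
qed

definition diagonal_prog :: recf where
  "diagonal_prog = PrimRec Zero (Comp add_prog [Proj 1, Comp sub_prog [Comp Succ [Zero],
     Comp sub_prog [Comp triangle_prog [Comp Succ [Proj 1]], Comp Succ [Proj 0]]]])"

lemma run_diagonal_prog: "run diagonal_prog [z] = Some (diagonal z)"
  unfolding diagonal_prog_def diagonal_def
  by (rule run_PrimRec) (simp_all add: run_add_prog run_sub_prog run_triangle_prog del: triangle_Suc)

definition fst_prog :: recf where
  "fst_prog = Comp sub_prog [Proj 0, Comp triangle_prog [diagonal_prog]]"

lemma run_fst_prog: "run fst_prog [prod_encode (a, b)] = Some a"
  unfolding fst_prog_def
  by (simp add: run_sub_prog run_triangle_prog run_diagonal_prog diagonal_prod_encode
      del: triangle_Suc) (simp add: prod_encode_def)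

definition snd_prog :: recf where
  "snd_prog = Comp sub_prog [diagonal_prog, fst_prog]"

lemma run_snd_prog: "run snd_prog [prod_encode (a, b)] = Some b"
  unfolding snd_prog_def
  by (simp add: run_sub_prog run_fst_prog run_diagonal_prog diagonal_prod_encode)

subsection \<open>Closure properties\<close>

named_theorems computable_intros

lemma computable_id [computable_intros]: "computable (\<lambda>x. x)"
  unfolding computable_def by (rule exI[of _ "Proj 0"]) simp

lemma computable_compose:
  assumes "computable g" "computable f" shows "computable (\<lambda>x. g (f x))"
proof -
  from assms obtain p q where "\<forall>y. run p [enc y] = Some (enc (g y))" "\<forall>x. run q [enc x] = Some (enc (f x))"
    unfolding computable_def by auto
  then have "\<forall>x. run (Comp p [q]) [enc x] = Some (enc (g (f x)))"
    by simp
  then show ?thesis unfolding computable_def by blast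
qed

lemma computable_const [computable_intros]: "computable (\<lambda>_. c)"
proof -
  have "\<exists>p. \<forall>xs. run p xs = Some n" for n
  proof (induction n)
    case 0
    then show ?case using run.simps(1) by blast
  next
    case (Suc n)
    then obtain p where "\<forall>xs. run p xs = Some n" by auto
    then have "\<forall>xs. run (Comp Succ [p]) xs = Some (Suc n)" by simp
    then show ?case by blast
  qed
  then show ?thesis unfolding computable_def by blast
qed

lemma computable_Pair [computable_intros]:
  assumes "computable f" "computable g" shows "computable (\<lambda>x. (f x, g x))"
proof -
  from assms obtain p q where "\<forall>x. run p [enc x] = Some (enc (f x))" "\<forall>x. run q [enc x] = Some (enc (g x))"
    unfolding computable_def by auto
  then have "\<forall>x. run (Comp pair_prog [p, q]) [enc x] = Some (enc (f x, g x))"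
    by (simp add: run_pair_prog enc_Pair)
  then show ?thesis unfolding computable_def by blast
qed

lemma computable_fst [computable_intros]: "computable f \<Longrightarrow> computable (\<lambda>x. fst (f x))"
  by (rule computable_compose, unfold computable_def, rule exI[of _ fst_prog])
    (simp add: enc_prod_def run_fst_prog)

lemma computable_snd [computable_intros]: "computable f \<Longrightarrow> computable (\<lambda>x. snd (f x))"
  by (rule computable_compose, unfold computable_def, rule exI[of _ snd_prog])
    (simp add: enc_prod_def run_snd_prog)

lemma computable_enc [computable_intros]: "computable f \<Longrightarrow> computable (\<lambda>x. enc (f x))"
  unfolding computable_def by simp

lemma computable_dec [computable_intros]: "computable f \<Longrightarrow> computable (\<lambda>x. dec (f x))"
  unfolding computable_def by simp

lemma computable_Suc [computable_intros]: "computable f \<Longrightarrow> computable (\<lambda>x. Suc (f x))"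
  by (rule computable_compose, unfold computable_def, rule exI[of _ Succ]) simp

lemma computable_add [computable_intros]:
  assumes "computable f" "computable g" shows "computable (\<lambda>x. f x + g x :: nat)"
proof -
  have "computable (\<lambda>u. fst u + snd u :: nat)"
    unfolding computable_def
    by (rule exI[of _ "Comp add_prog [fst_prog, snd_prog]"])
      (simp add: run_add_prog enc_prod_def run_fst_prog run_snd_prog)
  from computable_compose[OF this computable_Pair[OF assms]] show ?thesis by simp
qed

lemma computable_diff [computable_intros]:
  assumes "computable f" "computable g" shows "computable (\<lambda>x. f x - g x :: nat)"
proof -
  have "computable (\<lambda>u. fst u - snd u :: nat)"
    unfolding computable_def
    by (rule exI[of _ "Comp sub_prog [fst_prog, snd_prog]"])
      (simp add: run_sub_prog enc_prod_def run_fst_prog run_snd_prog)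
  from computable_compose[OF this computable_Pair[OF assms]] show ?thesis by simp
qed

text \<open>A body with bound variables is required to be computable as a function of a single tuple that
  consists of the values of the bound variables and the ambient argument.  All closure rules below
  treat binders in this way; after instantiation only projections remain, so \<open>intro\<close> proves
  computability by descending through the term.\<close>

lemma computable_rec_nat [computable_intros]:
  assumes "computable n" "computable a" "computable (\<lambda>u. h (snd (snd u)) (fst u) (fst (snd u)))"
  shows "computable (\<lambda>x. rec_nat (a x) (h x) (n x))"
proof -
  from assms obtain pn pa ph where
    p: "\<forall>x. run pn [enc x] = Some (n x)" "\<forall>x. run pa [enc x] = Some (enc (a x))"
      "\<And>m r x. run ph [enc (m, r, x)] = Some (enc (h x m r))"
    unfolding computable_def by fastforce
  let ?g = "Comp ph [Comp pair_prog [Proj 0, Comp pair_prog [Proj 1, Proj 2]]]"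
  have "run (PrimRec pa ?g) (n x # [enc x]) = Some (enc (rec_nat (a x) (h x) (n x)))" for x
  proof -
    have "run (PrimRec pa ?g) (n x # [enc x])
      = Some (rec_nat (enc (a x)) (\<lambda>m r. enc (h x m (dec r))) (n x))"
    proof (rule run_PrimRec)
      fix m y
      show "run ?g (m # y # [enc x]) = Some (enc (h x m (dec y)))"
        using p(3)[of m "dec y" x] by (simp add: run_pair_prog enc_Pair)
    qed (simp add: p)
    also have "rec_nat (enc (a x)) (\<lambda>m r. enc (h x m (dec r))) k = enc (rec_nat (a x) (h x) k)" for k
      by (induction k) simp_all
    finally show ?thesis .
  qed
  moreover have "run (Comp (PrimRec pa ?g) [pn, Proj 0]) [enc x] = run (PrimRec pa ?g) [n x, enc x]" for x
    using p(1) by (intro run_Comp_2) simp_all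
  ultimately have "\<forall>x. run (Comp (PrimRec pa ?g) [pn, Proj 0]) [enc x] = Some (enc (rec_nat (a x) (h x) (n x)))"
    by metis
  then show ?thesis unfolding computable_def by blast
qed

lemma computable_case_nat [computable_intros]:
  assumes "computable n" "computable a" "computable (\<lambda>u. h (snd u) (fst u))"
  shows "computable (\<lambda>x. case n x of 0 \<Rightarrow> a x | Suc m \<Rightarrow> h x m)"
proof -
  have "computable (\<lambda>u. h (snd (snd u)) (fst u))"
    using computable_compose[OF assms(3) computable_Pair[OF computable_fst[OF computable_id]
      computable_snd[OF computable_snd[OF computable_id]]]] by simp
  then have "computable (\<lambda>x. rec_nat (a x) (\<lambda>m _. h x m) (n x))"
    by (intro computable_rec_nat assms)
  moreover have "rec_nat (a x) (\<lambda>m _. h x m) (n x) = (case n x of 0 \<Rightarrow> a x | Suc m \<Rightarrow> h x m)" for x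
    by (cases "n x") simp_all
  ultimately show ?thesis by simp
qed

lemma computable_Cons [computable_intros]:
  assumes "computable f" "computable g" shows "computable (\<lambda>x. f x # g x)"
proof -
  have "computable (\<lambda>x. dec (Suc (enc (f x, g x))) :: 'b list)"
    by (intro computable_intros assms)
  then show ?thesis by (simp flip: enc_Cons)
qed

lemma computable_case_list [computable_intros]:
  fixes l :: "'a::coded \<Rightarrow> 'b::coded list"
  assumes "computable l" "computable a" "computable (\<lambda>u. h (snd (snd u)) (fst u) (fst (snd u)))"
  shows "computable (\<lambda>x. case l x of [] \<Rightarrow> a x | y # ys \<Rightarrow> h x y ys)"
proof -
  have "computable (\<lambda>u. h (snd u) (fst (dec (fst u) :: 'b \<times> 'b list)) (snd (dec (fst u) :: 'b \<times> 'b list)))"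
    using computable_compose[OF assms(3), of "\<lambda>u. (fst (dec (fst u) :: 'b \<times> 'b list), snd (dec (fst u) :: 'b \<times> 'b list), snd u)"]
    by (simp add: computable_intros)
  then have "computable (\<lambda>x. case enc (l x) of 0 \<Rightarrow> a x | Suc m \<Rightarrow> h x (fst (dec m :: 'b \<times> 'b list)) (snd (dec m :: 'b \<times> 'b list)))"
    by (intro computable_intros assms)
  moreover have "(case enc (l x) of 0 \<Rightarrow> a x | Suc m \<Rightarrow> h x (fst (dec m :: 'b \<times> 'b list)) (snd (dec m :: 'b \<times> 'b list)))
     = (case l x of [] \<Rightarrow> a x | y # ys \<Rightarrow> h x y ys)" for x
    by (cases "l x") (simp_all add: enc_Nil enc_Cons)
  ultimately show ?thesis by simp
qed

subsection \<open>Lists\<close>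

lemma length_le_enc: "length xs \<le> enc xs"
proof (induction xs)
  case (Cons x xs)
  then show ?case using le_prod_encode_2[of "enc xs" "enc x"] by (simp add: enc_Cons enc_Pair)
qed simp

text \<open>A left fold is an iteration whose state is the unread rest of the list together with the
  accumulator.  The code of a list bounds its length, so that many iterations suffice.\<close>

lemma computable_foldl [computable_intros]:
  fixes l :: "'a::coded \<Rightarrow> 'b::coded list" and a :: "'a \<Rightarrow> 'c::coded"
  assumes "computable l" "computable a" "computable (\<lambda>u. h (snd (snd u)) (fst u) (fst (snd u)))"
  shows "computable (\<lambda>x. foldl (h x) (a x) (l x))"
proof -
  define step where "step x s = (case fst s of [] \<Rightarrow> s | y # ys \<Rightarrow> (ys, h x (snd s) y))"
    for x and s :: "'b list \<times> 'c"
  have "computable (\<lambda>u. h (snd (snd (snd (snd u)))) (snd (fst (snd (snd (snd u))))) (fst u))"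
    using computable_compose[OF assms(3),
        of "\<lambda>u. (snd (fst (snd (snd (snd u)))), fst u, snd (snd (snd (snd u))))"]
    by (simp add: computable_intros)
  then have "computable (\<lambda>x. snd (rec_nat (l x, a x) (\<lambda>_. step x) (enc (l x))))"
    unfolding step_def by (intro computable_intros assms)
  moreover have "snd (rec_nat (xs, b) (\<lambda>_. step x) n) = foldl (h x) b (take n xs)
      \<and> fst (rec_nat (xs, b) (\<lambda>_. step x) n) = drop n xs" for x n b xs
  proof (induction n)
    case (Suc n)
    show ?case
    proof (cases "drop n xs")
      case (Cons y ys)
      then have "n < length xs" by (metis drop_all list.distinct(1) not_le)
      with Cons have "take (Suc n) xs = take n xs @ [y]" "drop (Suc n) xs = ys"
        using Cons_nth_drop_Suc[of n xs] by (simp_all add: take_Suc_conv_app_nth)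
      with Suc Cons show ?thesis by (simp add: step_def)
    next
      case Nil
      with Suc show ?thesis by (simp add: step_def)
    qed
  qed simp
  then have "snd (rec_nat (l x, a x) (\<lambda>_. step x) (enc (l x))) = foldl (h x) (a x) (l x)" for x
    by (simp add: length_le_enc)
  ultimately show ?thesis by simp
qed

lemma computable_rev [computable_intros]:
  assumes "computable l" shows "computable (\<lambda>x. rev (l x))"
proof -
  have eq: "rev xs = foldl (\<lambda>zs z. z # zs) [] xs" for xs :: "'b list"
    by (simp add: rev_conv_fold foldl_conv_fold)
  show ?thesis unfolding eq by (intro computable_intros assms)
qed

lemma computable_foldr [computable_intros]:
  assumes "computable l" "computable a" "computable (\<lambda>u. h (snd (snd u)) (fst u) (fst (snd u)))"
  shows "computable (\<lambda>x. foldr (h x) (l x) (a x))"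
proof -
  have "computable (\<lambda>u. h (snd (snd u)) (fst (snd u)) (fst u))"
    using computable_compose[OF assms(3), of "\<lambda>u. (fst (snd u), fst u, snd (snd u))"]
    by (simp add: computable_intros)
  then show ?thesis unfolding foldr_conv_foldl by (intro computable_intros assms)
qed

lemma computable_append [computable_intros]:
  assumes "computable f" "computable g" shows "computable (\<lambda>x. f x @ g x)"
proof -
  have eq: "xs @ ys = foldr (\<lambda>z zs. z # zs) xs ys" for xs ys :: "'b list"
    by (induction xs) auto
  show ?thesis unfolding eq by (intro computable_intros assms)
qed

lemma computable_map [computable_intros]:
  fixes l :: "'a::coded \<Rightarrow> 'c::coded list" and h :: "'a \<Rightarrow> 'c \<Rightarrow> 'b::coded"
  assumes "computable l" "computable (\<lambda>u. h (snd u) (fst u))"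
  shows "computable (\<lambda>x. map (h x) (l x))"
proof -
  have eq: "map k xs = foldr (\<lambda>z zs. k z # zs) xs []" for xs :: "'c list" and k :: "'c \<Rightarrow> 'b"
    by (induction xs) auto
  have "computable (\<lambda>u. h (snd (snd u)) (fst u))"
    using computable_compose[OF assms(2), of "\<lambda>u. (fst u, snd (snd u))"] by (simp add: computable_intros)
  then show ?thesis unfolding eq by (intro computable_intros assms)
qed

lemma computable_concat [computable_intros]:
  assumes "computable l" shows "computable (\<lambda>x. concat (l x))"
proof -
  have eq: "concat xs = foldr (\<lambda>y ys. y @ ys) xs []" for xs :: "'b list list"
    by (induction xs) simp_all
  show ?thesis unfolding eq by (intro computable_intros assms)
qed

lemma computable_length [computable_intros]:
  assumes "computable l" shows "computable (\<lambda>x. length (l x))"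
proof -
  have eq: "length xs = foldr (\<lambda>z. Suc) xs 0" for xs :: "'b list"
    by (induction xs) auto
  show ?thesis unfolding eq by (intro computable_intros assms)
qed

lemma computable_nth_default [computable_intros]:
  assumes "computable d" "computable l" "computable n"
  shows "computable (\<lambda>x. nth_default (d x) (l x) (n x))"
proof -
  have tails: "drop n xs = rec_nat xs (\<lambda>_ ys. case ys of [] \<Rightarrow> [] | y # ys \<Rightarrow> ys) n" for n and xs :: "'b list"
  proof (induction n)
    case (Suc n)
    have "drop (Suc n) xs = (case drop n xs of [] \<Rightarrow> [] | y # ys \<Rightarrow> ys)"
      by (cases "drop n xs") (simp_all add: drop_Suc drop_tl)
    with Suc show ?case by simp
  qed simp
  have "nth_default c xs n = (case drop n xs of [] \<Rightarrow> c | y # ys \<Rightarrow> y)" for c n and xs :: "'b list"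
    using Cons_nth_drop_Suc[of n xs, symmetric] by (auto simp: nth_default_def)
  then have eq: "nth_default c xs n =
      (case rec_nat xs (\<lambda>_ ys. case ys of [] \<Rightarrow> [] | y # ys \<Rightarrow> ys) n of [] \<Rightarrow> c | y # ys \<Rightarrow> y)"
    for c n and xs :: "'b list"
    unfolding tails .
  show ?thesis unfolding eq by (intro computable_intros assms)
qed

section \<open>Decidable predicates\<close>

text \<open>The value \<open>0\<close> stands for truth because the operator \<^const>\<open>Mu\<close> searches for a zero.\<close>

definition decidable :: "('a::coded \<Rightarrow> bool) \<Rightarrow> bool" where
  "decidable P \<longleftrightarrow> computable (\<lambda>x. if P x then 0 else Suc 0)"

named_theorems decidable_intros

lemma computable_If [computable_intros]:
  assumes "decidable P" "computable f" "computable g"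
  shows "computable (\<lambda>x. if P x then f x else g x)"
proof -
  have eq: "(if P x then f x else g x) = (case (if P x then 0 else Suc 0) of 0 \<Rightarrow> f x | Suc _ \<Rightarrow> g x)" for x
    by simp
  have "computable (\<lambda>u. g (snd u))"
    by (rule computable_compose[OF assms(3)]) (intro computable_intros)
  then show ?thesis
    unfolding eq by (intro computable_case_nat assms) (use assms(1) in \<open>simp_all add: decidable_def\<close>)
qed

lemma decidable_compose: "decidable P \<Longrightarrow> computable f \<Longrightarrow> decidable (\<lambda>x. P (f x))"
  unfolding decidable_def by (rule computable_compose)

lemma decidable_eq_0: "computable f \<Longrightarrow> decidable (\<lambda>x. f x = (0::nat))"
proof -
  assume "computable f"
  then have "computable (\<lambda>x. case f x of 0 \<Rightarrow> 0 | Suc _ \<Rightarrow> Suc 0)"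
    by (intro computable_intros)
  moreover have "(case f x of 0 \<Rightarrow> 0 | Suc _ \<Rightarrow> Suc 0) = (if f x = 0 then 0 else Suc 0)" for x
    by (cases "f x") simp_all
  ultimately show ?thesis by (simp add: decidable_def)
qed

lemma decidable_const [decidable_intros]: "decidable (\<lambda>_. c)"
  unfolding decidable_def by (cases c) (auto intro: computable_intros)

lemma decidable_not [decidable_intros]:
  assumes "decidable P" shows "decidable (\<lambda>x. \<not> P x)"
proof -
  have "computable (\<lambda>x. if P x then Suc 0 else 0)"
    by (intro computable_intros assms)
  moreover have "(if P x then Suc 0 else 0) = (if \<not> P x then 0 else Suc 0)" for x by simp
  ultimately show ?thesis by (simp add: decidable_def)
qed

lemma decidable_conj [decidable_intros]:
  assumes "decidable P" "decidable Q" shows "decidable (\<lambda>x. P x \<and> Q x)"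
proof -
  have "computable (\<lambda>x. if P x then if Q x then 0 else Suc 0 else Suc 0)"
    by (intro computable_intros assms)
  moreover have "(if P x then if Q x then 0 else Suc 0 else Suc 0) = (if P x \<and> Q x then 0 else Suc 0)" for x
    by simp
  ultimately show ?thesis by (simp add: decidable_def)
qed

lemma decidable_disj [decidable_intros]:
  assumes "decidable P" "decidable Q" shows "decidable (\<lambda>x. P x \<or> Q x)"
  using decidable_not[OF decidable_conj[OF decidable_not decidable_not, OF assms]] by simp

lemma decidable_imp [decidable_intros]:
  assumes "decidable P" "decidable Q" shows "decidable (\<lambda>x. P x \<longrightarrow> Q x)"
  using decidable_disj[OF decidable_not, OF assms] by simp

lemma decidable_iff [decidable_intros]:
  assumes "decidable P" "decidable Q" shows "decidable (\<lambda>x. P x \<longleftrightarrow> Q x)"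
proof -
  have eq: "(P x \<longleftrightarrow> Q x) \<longleftrightarrow> (P x \<longrightarrow> Q x) \<and> (Q x \<longrightarrow> P x)" for x by blast
  show ?thesis unfolding eq by (intro decidable_intros assms)
qed

lemma decidable_le [decidable_intros]:
  assumes "computable f" "computable g" shows "decidable (\<lambda>x. f x \<le> (g x :: nat))"
proof -
  have "decidable (\<lambda>x. f x - g x = 0)"
    by (intro decidable_eq_0 computable_intros assms)
  then show ?thesis by simp
qed

lemma decidable_less [decidable_intros]:
  assumes "computable f" "computable g" shows "decidable (\<lambda>x. f x < (g x :: nat))"
  using decidable_not[OF decidable_le[OF assms(2,1)]] by (simp add: not_le)

lemma decidable_eq [decidable_intros]:
  assumes "computable f" "computable g" shows "decidable (\<lambda>x. f x = g x)"
proof -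
  have "decidable (\<lambda>x. enc (f x) \<le> enc (g x) \<and> enc (g x) \<le> enc (f x))"
    by (intro decidable_intros computable_intros assms)
  then show ?thesis by (simp add: eq_iff[symmetric])
qed

lemma decidable_Ball_set [decidable_intros]:
  assumes "computable l" "decidable (\<lambda>u. P (snd u) (fst u))"
  shows "decidable (\<lambda>x. \<forall>y \<in> set (l x). P x y)"
proof -
  have eq: "(\<forall>y \<in> set ys. Q y) \<longleftrightarrow> foldr (\<lambda>y r. if Q y then r else Suc 0) ys 0 = 0" for Q and ys :: "'b list"
    by (induction ys) auto
  have "decidable (\<lambda>u. P (snd (snd u)) (fst u))"
    using decidable_compose[OF assms(2), of "\<lambda>u. (fst u, snd (snd u))"] by (simp add: computable_intros)
  then show ?thesis unfolding eq by (intro decidable_eq_0 computable_intros assms)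
qed

lemma decidable_Bex_set [decidable_intros]:
  assumes "computable l" "decidable (\<lambda>u. P (snd u) (fst u))"
  shows "decidable (\<lambda>x. \<exists>y \<in> set (l x). P x y)"
  using decidable_not[OF decidable_Ball_set[OF assms(1), of "\<lambda>x y. \<not> P x y"]] decidable_not[OF assms(2)] by simp

lemma decidable_in_set [decidable_intros]:
  assumes "computable f" "computable l" shows "decidable (\<lambda>x. f x \<in> set (l x))"
proof -
  have "decidable (\<lambda>u. f (snd u) = fst u)"
    by (intro decidable_intros computable_intros computable_compose[OF assms(1)])
  from decidable_Bex_set[OF assms(2) this] show ?thesis by simp
qed

lemma computable_upt [computable_intros]:
  assumes "computable n" shows "computable (\<lambda>x. [0..<n x])"
proof -
  have eq: "[0..<k] = rec_nat [] (\<lambda>m r. r @ [m]) k" for k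
    by (induction k) auto
  show ?thesis unfolding eq by (intro computable_intros assms)
qed

lemma decidable_all_less [decidable_intros]:
  fixes n :: "'a::coded \<Rightarrow> nat"
  assumes "computable n" "decidable (\<lambda>u. P (snd u) (fst u))"
  shows "decidable (\<lambda>x. \<forall>i < n x. P x i)"
  using decidable_Ball_set[OF computable_upt[OF assms(1)] assms(2)] by (simp add: Ball_def Bex_def)

lemma decidable_ex_less [decidable_intros]:
  fixes n :: "'a::coded \<Rightarrow> nat"
  assumes "computable n" "decidable (\<lambda>u. P (snd u) (fst u))"
  shows "decidable (\<lambda>x. \<exists>i < n x. P x i)"
  using decidable_Bex_set[OF computable_upt[OF assms(1)] assms(2)] by (simp add: Ball_def Bex_def)

section \<open>Semidecidable predicates\<close>

definition semidecidable :: "('a::coded \<Rightarrow> bool) \<Rightarrow> bool" where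
  "semidecidable P \<longleftrightarrow> (\<exists>t. decidable t \<and> (\<forall>x. P x \<longleftrightarrow> (\<exists>k::nat. t (k, x))))"

named_theorems semidecidable_intros

lemma semidecidable_decidable:
  assumes "decidable P" shows "semidecidable P"
proof -
  have "decidable (\<lambda>u::nat \<times> 'a. P (snd u))"
    by (rule decidable_compose[OF assms]) (intro computable_intros)
  then show ?thesis unfolding semidecidable_def by (intro exI[of _ "\<lambda>u. P (snd u)"]) simp
qed

lemma semidecidable_compose:
  assumes "semidecidable P" "computable f" shows "semidecidable (\<lambda>x. P (f x))"
proof -
  obtain t where "decidable t" and t: "\<forall>x. P x \<longleftrightarrow> (\<exists>k::nat. t (k, x))"
    using assms(1) unfolding semidecidable_def by auto
  have "computable (\<lambda>u::nat \<times> _. (fst u, f (snd u)))"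
    by (intro computable_intros computable_compose[OF assms(2)])
  with \<open>decidable t\<close> have "decidable (\<lambda>u. t (fst u, f (snd u)))"
    by (rule decidable_compose)
  with t show ?thesis
    unfolding semidecidable_def by (intro exI[of _ "\<lambda>u. t (fst u, f (snd u))"]) simp
qed

lemma semidecidable_conj [semidecidable_intros]:
  assumes "semidecidable P" "semidecidable Q" shows "semidecidable (\<lambda>x. P x \<and> Q x)"
proof -
  obtain s t where st: "decidable s" "\<forall>x. P x \<longleftrightarrow> (\<exists>k::nat. s (k, x))"
      "decidable t" "\<forall>x. Q x \<longleftrightarrow> (\<exists>k::nat. t (k, x))"
    using assms unfolding semidecidable_def by auto
  let ?t = "\<lambda>u. s (fst (dec (fst u) :: nat \<times> nat), snd u) \<and> t (snd (dec (fst u) :: nat \<times> nat), snd u)"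
  have "decidable ?t"
    by (intro decidable_intros decidable_compose[OF st(1)] decidable_compose[OF st(3)] computable_intros)
  moreover have "P x \<and> Q x \<longleftrightarrow> (\<exists>k::nat. ?t (k, x))" for x
  proof
    assume "P x \<and> Q x"
    then obtain i j where "s (i, x)" "t (j, x)" using st by auto
    then show "\<exists>k::nat. ?t (k, x)" by (intro exI[of _ "enc (i, j)"]) simp
  qed (use st in auto)
  ultimately show ?thesis unfolding semidecidable_def by blast
qed

lemma semidecidable_disj [semidecidable_intros]:
  assumes "semidecidable P" "semidecidable Q" shows "semidecidable (\<lambda>x. P x \<or> Q x)"
proof -
  obtain s t where st: "decidable s" "\<forall>x. P x \<longleftrightarrow> (\<exists>k::nat. s (k, x))"
      "decidable t" "\<forall>x. Q x \<longleftrightarrow> (\<exists>k::nat. t (k, x))"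
    using assms unfolding semidecidable_def by auto
  have "decidable (\<lambda>u. s u \<or> t u)"
    by (intro decidable_intros st)
  then show ?thesis unfolding semidecidable_def using st(2,4) by (intro exI[of _ "\<lambda>u. s u \<or> t u"]) auto
qed

lemma semidecidable_ex [semidecidable_intros]:
  fixes P :: "'a::coded \<Rightarrow> 'b::coded \<Rightarrow> bool"
  assumes "semidecidable (\<lambda>u. P (snd u) (fst u))" shows "semidecidable (\<lambda>x. \<exists>y. P x y)"
proof -
  obtain t where t: "decidable t" "\<forall>u. P (snd u) (fst u) \<longleftrightarrow> (\<exists>k::nat. t (k, u))"
    using assms unfolding semidecidable_def by auto
  let ?t = "\<lambda>u. t (fst (dec (fst u) :: nat \<times> 'b), snd (dec (fst u) :: nat \<times> 'b), snd u)"
  have "decidable ?t"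
    by (intro decidable_compose[OF t(1)] computable_intros)
  moreover have "(\<exists>y. P x y) \<longleftrightarrow> (\<exists>k::nat. ?t (k, x))" for x
  proof
    assume "\<exists>y. P x y"
    then obtain y k where "t (k, y, x)" using t(2) by (metis fst_conv snd_conv)
    then show "\<exists>k::nat. ?t (k, x)" by (intro exI[of _ "enc (k, y)"]) simp
  qed (use t(2) in \<open>metis fst_conv snd_conv\<close>)
  ultimately show ?thesis unfolding semidecidable_def by blast
qed

text \<open>Finitely many witnesses have a common bound, so the search for them can be postponed to the
  outside of the bounded quantifier.\<close>

lemma semidecidable_all_less [semidecidable_intros]:
  fixes n :: "'a::coded \<Rightarrow> nat"
  assumes "computable n" "semidecidable (\<lambda>u. P (snd u) (fst u))"
  shows "semidecidable (\<lambda>x. \<forall>i < n x. P x i)"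
proof -
  obtain t where t: "decidable t" "\<forall>u. P (snd u) (fst u) \<longleftrightarrow> (\<exists>k::nat. t (k, u))"
    using assms unfolding semidecidable_def by auto
  let ?t = "\<lambda>u. \<forall>i < n (snd u). \<exists>k < fst u. t (k, i, snd u)"
  have "decidable ?t"
    by (intro decidable_intros decidable_compose[OF t(1)] computable_compose[OF assms(1)] computable_intros)
  moreover have "(\<forall>i < n x. P x i) \<longleftrightarrow> (\<exists>m::nat. ?t (m, x))" for x
  proof
    assume "\<forall>i < n x. P x i"
    then have "\<forall>i. \<exists>k. i < n x \<longrightarrow> t (k, i, x)" using t(2) by (metis fst_conv snd_conv)
    then obtain k where "\<And>i. i < n x \<Longrightarrow> t (k i, i, x)" by metis
    moreover have "k i < Suc (\<Sum>i < n x. k i)" if "i < n x" for i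
      using that by (simp add: le_imp_less_Suc member_le_sum)
    ultimately have "?t (Suc (\<Sum>i < n x. k i), x)" by auto
    then show "\<exists>m::nat. ?t (m, x)" by blast
  qed (use t(2) in \<open>metis fst_conv snd_conv\<close>)
  ultimately show ?thesis unfolding semidecidable_def by blast
qed

text \<open>A finite path is coded by the list of its vertices, so reachability is an unbounded search over
  lists with a bounded check of the steps.\<close>

lemma semidecidable_rtranclp [semidecidable_intros]:
  assumes "semidecidable (\<lambda>u. r (snd (snd u)) (fst u) (fst (snd u)))" "computable f" "computable g"
  shows "semidecidable (\<lambda>x. (r x)\<^sup>*\<^sup>* (f x) (g x))"
proof -
  have eq: "(r x)\<^sup>*\<^sup>* a b \<longleftrightarrow> (\<exists>n ys. nth_default a ys 0 = a \<and> nth_default a ys n = b \<and>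
      (\<forall>i < n. r x (nth_default a ys i) (nth_default a ys (Suc i))))" for x a b
  proof
    assume "(r x)\<^sup>*\<^sup>* a b"
    then obtain n p where "p 0 = a" "p n = b" "\<forall>i < n. r x (p i) (p (Suc i))"
      unfolding rtranclp_power relpowp_fun_conv by auto
    then have "nth_default a (map p [0..<Suc n]) 0 = a \<and> nth_default a (map p [0..<Suc n]) n = b \<and>
      (\<forall>i < n. r x (nth_default a (map p [0..<Suc n]) i) (nth_default a (map p [0..<Suc n]) (Suc i)))"
      by (simp add: nth_default_def del: upt_Suc)
    then show "\<exists>n ys. nth_default a ys 0 = a \<and> nth_default a ys n = b \<and>
      (\<forall>i < n. r x (nth_default a ys i) (nth_default a ys (Suc i)))" by blast
  next
    assume "\<exists>n ys. nth_default a ys 0 = a \<and> nth_default a ys n = b \<and>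
      (\<forall>i < n. r x (nth_default a ys i) (nth_default a ys (Suc i)))"
    then show "(r x)\<^sup>*\<^sup>* a b"
      unfolding rtranclp_power relpowp_fun_conv by blast
  qed
  have step: "semidecidable (\<lambda>u. r (snd (snd (snd u))) (h1 u) (h2 u))"
    if "computable h1" "computable h2" for h1 h2
    using semidecidable_compose[OF assms(1), of "\<lambda>u. (h1 u, h2 u, snd (snd (snd u)))"] that
    by (simp add: computable_intros)
  show ?thesis
    unfolding eq
    by (intro semidecidable_intros step; intro semidecidable_decidable decidable_intros computable_intros
        computable_compose[OF assms(2)] computable_compose[OF assms(3)])
qed

section \<open>The graphs of partial recursive functions\<close>

lemma run_Comp_iff:
  "run (Comp f gs) xs = Some v \<longleftrightarrow>
     (\<exists>ys. map (\<lambda>g. run g xs) gs = map Some ys \<and> run f ys = Some v)"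
proof
  assume *: "run (Comp f gs) xs = Some v"
  then have "None \<notin> (\<lambda>g. run g xs) ` set gs" and v: "run f (map (\<lambda>g. the (run g xs)) gs) = Some v"
    by (auto simp: Let_def comp_def split: if_splits)
  then have "\<forall>g \<in> set gs. run g xs \<noteq> None" by (metis image_eqI)
  with v show "\<exists>ys. map (\<lambda>g. run g xs) gs = map Some ys \<and> run f ys = Some v"
    by (intro exI[of _ "map (\<lambda>g. the (run g xs)) gs"]) (auto simp: comp_def)
next
  assume "\<exists>ys. map (\<lambda>g. run g xs) gs = map Some ys \<and> run f ys = Some v"
  then obtain ys where "list_all2 (=) (map (\<lambda>g. run g xs) gs) (map Some ys)" "run f ys = Some v"
    by (auto simp: list.rel_eq)
  then show "run (Comp f gs) xs = Some v"
    using run_Comp[of xs gs ys f] by (simp add: list.rel_map del: run.simps)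
qed

text \<open>The list \<open>rs\<close> holds the successive values of the recursion; that they are all defined is part of
  what the witness certifies.\<close>

lemma run_PrimRec_iff:
  "run (PrimRec f g) xs = Some v \<longleftrightarrow>
     (\<exists>n zs rs. xs = n # zs \<and> run f zs = Some (nth_default 0 rs 0) \<and>
        (\<forall>m < n. run g (m # nth_default 0 rs m # zs) = Some (nth_default 0 rs (Suc m))) \<and>
        nth_default 0 rs n = v)"
proof (cases xs)
  case (Cons n zs)
  define it where "it = rec_nat (run f zs) (\<lambda>m r. Option.bind r (\<lambda>y. run g (m # y # zs)))"
  have it [simp]: "it 0 = run f zs" "it (Suc m) = Option.bind (it m) (\<lambda>y. run g (m # y # zs))" for m
    by (simp_all add: it_def)
  have run: "run (PrimRec f g) xs = it n"
    by (simp add: Cons it_def)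
  show ?thesis
  proof
    assume "run (PrimRec f g) xs = Some v"
    then have n: "it n = Some v" by (simp only: run)
    have all: "it m \<noteq> None" if "m \<le> n" for m
      using that n by (induction rule: inc_induct) (auto simp: bind_eq_Some_conv)
    define rs where "rs = map (\<lambda>m. the (it m)) [0..<Suc n]"
    have rs: "it m = Some (nth_default 0 rs m)" if "m \<le> n" for m
      using that all[OF that] by (auto simp: rs_def nth_default_def simp del: upt_Suc)
    have "run g (m # nth_default 0 rs m # zs) = Some (nth_default 0 rs (Suc m))" if "m < n" for m
      using rs[of m] rs[of "Suc m"] that by simp
    then show "\<exists>n zs rs. xs = n # zs \<and> run f zs = Some (nth_default 0 rs 0) \<and>
        (\<forall>m < n. run g (m # nth_default 0 rs m # zs) = Some (nth_default 0 rs (Suc m))) \<and>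
        nth_default 0 rs n = v"
      using Cons rs[of 0] rs[of n] n by auto
  next
    assume "\<exists>n zs rs. xs = n # zs \<and> run f zs = Some (nth_default 0 rs 0) \<and>
        (\<forall>m < n. run g (m # nth_default 0 rs m # zs) = Some (nth_default 0 rs (Suc m))) \<and>
        nth_default 0 rs n = v"
    then obtain rs where rs: "run f zs = Some (nth_default 0 rs 0)"
        "\<forall>m < n. run g (m # nth_default 0 rs m # zs) = Some (nth_default 0 rs (Suc m))"
        "nth_default 0 rs n = v"
      using Cons by auto
    have "it m = Some (nth_default 0 rs m)" if "m \<le> n" for m
      using that by (induction m) (use rs in auto)
    then show "run (PrimRec f g) xs = Some v"
      using rs(3) run by simp
  qed
qed simp

lemma run_Mu_iff:
  "run (Mu f) xs = Some v \<longleftrightarrow>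
     run f (v # xs) = Some 0 \<and> (\<forall>i < v. \<exists>y. 0 < y \<and> run f (i # xs) = Some y)"
proof -
  have "(LEAST n. run f (n # xs) = Some 0) = n"
    if "run f (n # xs) = Some 0" "\<forall>i < n. \<exists>y>0. run f (i # xs) = Some y" for n
    using that by (intro Least_equality) (auto simp: not_less[symmetric])
  then show ?thesis by auto
qed

text \<open>This is what remains of Kleene's normal form theorem when only semidecidability is wanted: a
  computation is witnessed by its intermediate values, and these can be searched for.  Procedures that are reliable on valid inputs only can therefore be used inside
  a search, since a run that does not end contributes nothing.\<close>

theorem semidecidable_run_graph: "semidecidable (\<lambda>u. run p (fst u) = Some (snd u))"
proof (induction p)
  case Zero
  show ?case by (simp, intro semidecidable_decidable decidable_intros computable_intros)
next
  case Succ
  have eq: "run Succ xs = Some v \<longleftrightarrow> (\<exists>y ys. xs = y # ys \<and> v = Suc y)" for xs v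
    by (auto split: list.split)
  show ?case
    unfolding eq by (intro semidecidable_intros; intro semidecidable_decidable decidable_intros computable_intros)
next
  case (Proj i)
  have eq: "run (Proj i) xs = Some v \<longleftrightarrow> i < length xs \<and> nth_default 0 xs i = v" for xs v
    by (simp add: nth_default_def)
  show ?case
    unfolding eq by (intro semidecidable_decidable decidable_intros computable_intros)
next
  case (Comp f gs)
  have "semidecidable (\<lambda>u. map (\<lambda>g. run g (fst u)) gs = map Some (snd u))"
    using Comp.IH(2)
  proof (induction gs)
    case Nil
    have eq: "map (\<lambda>g. run g xs) [] = map Some ys \<longleftrightarrow> ys = []" for xs and ys :: "nat list"
      by simp
    show ?case unfolding eq by (intro semidecidable_decidable decidable_intros computable_intros)
  next
    case (Cons g gs)
    have eq: "map (\<lambda>g. run g xs) (g # gs) = map Some ys \<longleftrightarrow> (\<exists>z zs. ys = z # zs \<and>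
      run g xs = Some z \<and> map (\<lambda>g. run g xs) gs = map Some zs)" for xs ys
      by auto
    have "semidecidable (\<lambda>u. run g (fst u) = Some (snd u))"
      "semidecidable (\<lambda>u. map (\<lambda>g. run g (fst u)) gs = map Some (snd u))"
      using Cons by simp_all
    note IH = this[THEN semidecidable_compose]
    have 1: "semidecidable (\<lambda>u. run g (h u) = Some (k u))"
      if "computable h" "computable k" for h k
      using IH(1)[OF computable_Pair[OF that]] by simp
    have 2: "semidecidable (\<lambda>u. map (\<lambda>g. run g (h u)) gs = map Some (k u))"
      if "computable h" "computable k" for h k
      using IH(2)[OF computable_Pair[OF that]] by simp
    show ?case
      unfolding eq by (intro semidecidable_intros 1 2; intro semidecidable_decidable decidable_intros computable_intros)
  qed
  note IH = this[THEN semidecidable_compose] Comp.IH(1)[THEN semidecidable_compose]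
  have 1: "semidecidable (\<lambda>u. map (\<lambda>g. run g (h u)) gs = map Some (k u))"
    if "computable h" "computable k" for h k
    using IH(1)[OF computable_Pair[OF that]] by simp
  have 2: "semidecidable (\<lambda>u. run f (h u) = Some (k u))"
    if "computable h" "computable k" for h k
    using IH(2)[OF computable_Pair[OF that]] by simp
  show ?case
    unfolding run_Comp_iff by (intro semidecidable_intros 1 2; intro computable_intros)
next
  case (PrimRec f g)
  note IH = this[THEN semidecidable_compose]
  have 1: "semidecidable (\<lambda>u. run f (h u) = Some (k u))"
    if "computable h" "computable k" for h k
    using IH(1)[OF computable_Pair[OF that]] by simp
  have 2: "semidecidable (\<lambda>u. run g (h u) = Some (k u))"
    if "computable h" "computable k" for h k
    using IH(2)[OF computable_Pair[OF that]] by simp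
  show ?case
    unfolding run_PrimRec_iff
    by (intro semidecidable_intros 1 2; (intro semidecidable_decidable decidable_intros)?; intro computable_intros)
next
  case (Mu f)
  note IH = this[THEN semidecidable_compose]
  have 1: "semidecidable (\<lambda>u. run f (h u) = Some (k u))"
    if "computable h" "computable k" for h k
    using IH[OF computable_Pair[OF that]] by simp
  show ?case
    unfolding run_Mu_iff
    by (intro semidecidable_intros 1; (intro semidecidable_decidable decidable_intros)?; intro computable_intros)
qed

lemma semidecidable_run [semidecidable_intros]:
  assumes "computable f" "computable g" shows "semidecidable (\<lambda>x. run p (f x) = Some (g x))"
  using semidecidable_compose[OF semidecidable_run_graph computable_Pair[OF assms]] by simp

section \<open>Two complementary searches\<close>

text \<open>Post's theorem: run both searches and see which one succeeds first.  The predicates need to be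
  complementary only at the input in question, because the decision problems say nothing about
  inputs that do not code an instance.\<close>

theorem decide_by_complementary_searches:
  assumes "semidecidable P" "semidecidable N"
  obtains p where "\<And>x. N x \<longleftrightarrow> \<not> P x \<Longrightarrow> run p [enc x] = Some (if P x then 1 else 0)"
proof -
  obtain s t where st: "decidable s" "\<And>x. P x \<longleftrightarrow> (\<exists>k::nat. s (k, x))"
      "decidable t" "\<And>x. N x \<longleftrightarrow> (\<exists>k::nat. t (k, x))"
    using assms unfolding semidecidable_def by auto
  have "computable (\<lambda>u. if s u \<or> t u then 0 else Suc 0)" "computable (\<lambda>u. if s u then Suc 0 else 0)"
    by (intro computable_intros decidable_intros st)+
  then obtain q r where q: "\<And>u. run q [enc u] = Some (if s u \<or> t u then 0 else Suc 0)"
      and r: "\<And>u. run r [enc u] = Some (if s u then Suc 0 else 0)"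
    unfolding computable_def by auto
  let ?q = "Comp q [pair_prog]" and ?r = "Comp r [pair_prog]"
  have run_q: "run ?q [k, enc x] = Some (if s (k, x) \<or> t (k, x) then 0 else Suc 0)" for k x
    using q[of "(k, x)"] by (simp add: run_pair_prog enc_Pair)
  have run_r: "run ?r [k, enc x] = Some (if s (k, x) then Suc 0 else 0)" for k x
    using r[of "(k, x)"] by (simp add: run_pair_prog enc_Pair)
  have "run (Comp ?r [Mu ?q, Proj 0]) [enc x] = Some (if P x then 1 else 0)" if "N x \<longleftrightarrow> \<not> P x" for x
  proof -
    have "\<exists>k. s (k, x) \<or> t (k, x)" using that st by auto
    then have "s (LEAST k. s (k, x) \<or> t (k, x), x) \<or> t (LEAST k. s (k, x) \<or> t (k, x), x)"
      "\<forall>i < (LEAST k. s (k, x) \<or> t (k, x)). \<not> (s (i, x) \<or> t (i, x))"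
      by (rule LeastI_ex) (blast dest: not_less_Least)
    then obtain k where k: "s (k, x) \<or> t (k, x)" "\<forall>i < k. \<not> (s (i, x) \<or> t (i, x))" by blast
    then have "run (Mu ?q) [enc x] = Some k"
      unfolding run_Mu_iff run_q by simp
    then have "run (Comp ?r [Mu ?q, Proj 0]) [enc x] = run ?r [k, enc x]"
      by (intro run_Comp_2) simp_all
    also have "\<dots> = Some (if s (k, x) then 1 else 0)" unfolding run_r by simp
    also have "s (k, x) \<longleftrightarrow> P x" using k(1) that st(2,4) by blast
    finally show ?thesis .
  qed
  then show thesis by (rule that)
qed

section \<open>Halving and set codes\<close>

lemma rec_nat_div_mod_2:
  "rec_nat (0, 0) (\<lambda>_ s. if snd s = 0 then (fst s, Suc 0) else (Suc (fst s), 0)) n = (n div 2, n mod (2::nat))"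
proof (induction n)
  case (Suc n)
  have "n mod 2 = 0 \<Longrightarrow> Suc n div 2 = n div 2 \<and> Suc n mod 2 = 1"
    "n mod 2 \<noteq> 0 \<Longrightarrow> Suc n div 2 = Suc (n div 2) \<and> Suc n mod 2 = 0"
    by presburger+
  with Suc show ?case by auto
qed simp

lemma computable_div_2 [computable_intros]:
  assumes "computable f" shows "computable (\<lambda>x. f x div (2::nat))"
proof -
  have eq: "n div 2 = fst (rec_nat (0, 0) (\<lambda>_ s. if snd s = 0 then (fst s, Suc 0) else (Suc (fst s), 0)) n)" for n :: nat
    by (simp add: rec_nat_div_mod_2)
  show ?thesis unfolding eq by (intro computable_intros decidable_intros assms)
qed

lemma decidable_even [decidable_intros]:
  assumes "computable f" shows "decidable (\<lambda>x. even (f x :: nat))"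
proof -
  have eq: "even n \<longleftrightarrow> n = n div 2 + n div 2" for n :: nat by presburger
  show ?thesis unfolding eq by (intro computable_intros decidable_intros assms)
qed

text \<open>Membership is a binary digit, which is brought to the last place by repeated halving.\<close>

lemma decidable_in_set_decode [decidable_intros]:
  assumes "computable f" "computable g" shows "decidable (\<lambda>x. f x \<in> set_decode (g x))"
proof -
  have "n \<in> set_decode v \<longleftrightarrow> \<not> even (rec_nat v (\<lambda>_ w. w div 2) n)" for n v
  proof -
    have "rec_nat v (\<lambda>_ w. w div 2) n = v div 2 ^ n"
      by (induction n) (simp_all add: div_mult2_eq[symmetric] mult.commute)
    then show ?thesis by (simp add: set_decode_def)
  qed
  note eq = this
  show ?thesis unfolding eq by (intro computable_intros decidable_intros assms)
qed

section \<open>Words in a presented group\<close>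

text \<open>The letters \<open>2 * i\<close> and \<open>2 * i + 1\<close> stand for the \<open>i\<close>-th generator and its inverse.\<close>

definition flip :: "nat \<Rightarrow> nat" where "flip l = (if even l then Suc l else l - 1)"

definition inverse_word :: "nat list \<Rightarrow> nat list" where "inverse_word w = rev (map flip w)"

definition nat_words :: "nat \<Rightarrow> nat list set" where "nat_words N = {w. \<forall>l \<in> set w. l < N + N}"

definition eval_word :: "('a, 'b) monoid_scheme \<Rightarrow> (nat \<Rightarrow> 'a) \<Rightarrow> nat list \<Rightarrow> 'a" where
  "eval_word G gen w = foldr (\<lambda>l a. gen l \<otimes>\<^bsub>G\<^esub> a) w \<one>\<^bsub>G\<^esub>"

text \<open>The relation \<^const>\<open>insertion\<close> for words that are written in the letters \<open>0, \<dots>, 2 * N - 1\<close>.\<close>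

definition nat_insertion :: "nat \<Rightarrow> nat list set \<Rightarrow> nat list \<Rightarrow> nat list \<Rightarrow> bool" where
  "nat_insertion N R u v \<longleftrightarrow> (\<exists>a b. u = a @ b \<and>
     ((\<exists>l < N + N. v = a @ [l, flip l] @ b) \<or> (\<exists>r \<in> R. v = a @ r @ b)))"

lemma flip_less: "l < N + N \<Longrightarrow> flip l < N + N"
  by (cases "even l"; simp add: flip_def; presburger)

lemma flip_flip [simp]: "flip (flip l) = l"
  by (auto simp: flip_def)

lemma nat_words_simps [simp]:
  "[] \<in> nat_words N" "l # w \<in> nat_words N \<longleftrightarrow> l < N + N \<and> w \<in> nat_words N"
  "u @ w \<in> nat_words N \<longleftrightarrow> u \<in> nat_words N \<and> w \<in> nat_words N"
  by (auto simp: nat_words_def)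

lemma inverse_word_nat_words [simp]: "w \<in> nat_words N \<Longrightarrow> inverse_word w \<in> nat_words N"
  by (auto simp: nat_words_def inverse_word_def flip_less)

lemma inverse_word_simps [simp]:
  "inverse_word [] = []" "inverse_word (l # w) = inverse_word w @ [flip l]"
  by (simp_all add: inverse_word_def)

lemma eval_word_simps [simp]:
  "eval_word G gen [] = \<one>\<^bsub>G\<^esub>" "eval_word G gen (l # w) = gen l \<otimes>\<^bsub>G\<^esub> eval_word G gen w"
  by (simp_all add: eval_word_def)

lemma nat_insertion_nat_words:
  assumes "R \<subseteq> nat_words N" "nat_insertion N R u v" shows "u \<in> nat_words N \<longleftrightarrow> v \<in> nat_words N"
  using assms by (auto simp: nat_insertion_def flip_less)

lemma equivclp_map:
  assumes "equivclp r x y" "\<And>x y. r x y \<Longrightarrow> equivclp s (f x) (f y)"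
  shows "equivclp s (f x) (f y)"
  using assms(1)
proof (induction rule: equivclp_induct)
  case (step y z)
  then have "equivclp s (f y) (f z)" using assms(2) equivclp_sym by metis
  with step show ?case by (metis equivclp_trans)
qed simp

lemma equivclp_base: "r x y \<Longrightarrow> equivclp r x y"
  by (simp add: equivclp_def r_into_rtranclp symclpI1)

locale word_group = group G for G (structure) +
  fixes N :: nat and gen :: "nat \<Rightarrow> 'a"
  assumes gen_closed: "l < N + N \<Longrightarrow> gen l \<in> carrier G"
    and gen_flip: "l < N + N \<Longrightarrow> gen l \<otimes> gen (flip l) = \<one>"
begin

lemma eval_word_closed [simp]: "w \<in> nat_words N \<Longrightarrow> eval_word G gen w \<in> carrier G"
  by (induction w) (simp_all add: gen_closed)

lemma eval_word_append:
  "u \<in> nat_words N \<Longrightarrow> v \<in> nat_words N \<Longrightarrow> eval_word G gen (u @ v) = eval_word G gen u \<otimes> eval_word G gen v"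
  by (induction u) (simp_all add: gen_closed m_assoc)

lemma gen_flip_inv: "l < N + N \<Longrightarrow> gen (flip l) = inv (gen l)"
  using gen_closed flip_less inv_equality[of "gen (flip l)" "gen l"] gen_flip[of "flip l"] by simp

lemma eval_word_inverse_word: "w \<in> nat_words N \<Longrightarrow> eval_word G gen (inverse_word w) = inv (eval_word G gen w)"
  by (induction w) (simp_all add: gen_closed eval_word_append flip_less gen_flip_inv inv_mult_group)

lemma eval_word_nat_insertion:
  assumes "\<And>r. r \<in> R \<Longrightarrow> r \<in> nat_words N \<and> eval_word G gen r = \<one>" "nat_insertion N R u v" "u \<in> nat_words N"
  shows "eval_word G gen u = eval_word G gen v"
proof -
  from assms(2) obtain a b where u: "u = a @ b"
    and "(\<exists>l < N + N. v = a @ [l, flip l] @ b) \<or> (\<exists>r \<in> R. v = a @ r @ b)"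
    unfolding nat_insertion_def by blast
  then consider l where "l < N + N" "v = a @ [l, flip l] @ b" | r where "r \<in> R" "v = a @ r @ b"
    by blast
  then show ?thesis
  proof cases
    case 1
    have "eval_word G gen ([l, flip l] @ b) = (gen l \<otimes> gen (flip l)) \<otimes> eval_word G gen b"
      using 1 u assms(3) by (simp add: gen_closed flip_less m_assoc)
    also have "\<dots> = eval_word G gen b" using 1 u assms(3) by (simp add: gen_flip)
    finally have "eval_word G gen ([l, flip l] @ b) = eval_word G gen b" .
    moreover have "a \<in> nat_words N" "[l, flip l] @ b \<in> nat_words N" "b \<in> nat_words N"
      using 1 u assms(3) by (simp_all add: flip_less)
    ultimately show ?thesis unfolding u 1 by (metis eval_word_append)
  next
    case 2
    then show ?thesis using assms(1,3) u by (simp add: eval_word_append)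
  qed
qed

lemma eval_word_equivclp_nat_insertion:
  assumes R: "\<And>r. r \<in> R \<Longrightarrow> r \<in> nat_words N \<and> eval_word G gen r = \<one>"
    and "equivclp (nat_insertion N R) u v" "u \<in> nat_words N"
  shows "eval_word G gen u = eval_word G gen v"
proof -
  have "R \<subseteq> nat_words N" using R by auto
  from assms(2) have "v \<in> nat_words N \<and> eval_word G gen u = eval_word G gen v"
  proof (induction rule: equivclp_induct)
    case (step y z)
    then show ?case using eval_word_nat_insertion[OF R] nat_insertion_nat_words[OF \<open>R \<subseteq> nat_words N\<close>] by metis
  qed (use assms(3) in simp)
  then show ?thesis by simp
qed

end

locale presented_group = word_group +
  fixes R :: "nat list set"
  assumes relators: "R \<subseteq> nat_words N"
    and generates: "eval_word G gen ` nat_words N = carrier G"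
    and kernel: "\<And>w. w \<in> nat_words N \<Longrightarrow> eval_word G gen w = \<one> \<longleftrightarrow> equivclp (nat_insertion N R) [] w"
begin

abbreviation val :: "nat list \<Rightarrow> 'a" where "val \<equiv> eval_word G gen"

lemma val_cases: "x \<in> carrier G \<Longrightarrow> \<exists>w \<in> nat_words N. val w = x"
  using generates by (metis image_iff)

lemma relator_val: "r \<in> R \<Longrightarrow> r \<in> nat_words N \<and> val r = \<one>"
proof -
  assume "r \<in> R"
  then have "nat_insertion N R [] r" unfolding nat_insertion_def by force
  with \<open>r \<in> R\<close> show ?thesis using kernel relators equivclp_base by (metis subsetD)
qed

lemma nat_insertion_append_context: "nat_insertion N R u v \<Longrightarrow> nat_insertion N R (a @ u @ b) (a @ v @ b)"
proof -
  assume "nat_insertion N R u v"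
  then obtain c d where u: "u = c @ d" and
    v: "(\<exists>l < N + N. v = c @ [l, flip l] @ d) \<or> (\<exists>r \<in> R. v = c @ r @ d)"
    unfolding nat_insertion_def by blast
  have "a @ u @ b = (a @ c) @ (d @ b)" using u by simp
  moreover have "(\<exists>l < N + N. a @ v @ b = (a @ c) @ [l, flip l] @ (d @ b)) \<or>
      (\<exists>r \<in> R. a @ v @ b = (a @ c) @ r @ (d @ b))"
    using v by auto
  ultimately show ?thesis unfolding nat_insertion_def by blast
qed

lemma equivclp_nat_insertion_context:
  "equivclp (nat_insertion N R) u v \<Longrightarrow> equivclp (nat_insertion N R) (a @ u @ b) (a @ v @ b)"
  by (erule equivclp_map[where f = "\<lambda>u. a @ u @ b"]) (intro equivclp_base nat_insertion_append_context)

lemma inverse_word_cancel: "w \<in> nat_words N \<Longrightarrow> equivclp (nat_insertion N R) [] (inverse_word w @ w)"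
proof (induction w)
  case (Cons l w)
  then have "nat_insertion N R (inverse_word w @ w) (inverse_word w @ [flip l, l] @ w)"
    unfolding nat_insertion_def using flip_less[of l N] flip_flip[of l] by (metis nat_words_simps(2))
  with Cons show ?case by (simp add: equivclp_base equivclp_trans)
qed simp

text \<open>Inserting \<open>v\<^sup>-\<^sup>1 v\<close> behind \<open>u\<close> reduces equality of \<open>u\<close> and \<open>v\<close> to triviality of
  \<open>u v\<^sup>-\<^sup>1\<close>.\<close>

theorem val_eq_iff:
  assumes "u \<in> nat_words N" "v \<in> nat_words N"
  shows "val u = val v \<longleftrightarrow> equivclp (nat_insertion N R) u v"
proof
  assume "val u = val v"
  then have "val (u @ inverse_word v) = \<one>"
    using assms by (simp add: eval_word_append eval_word_inverse_word)
  then have "equivclp (nat_insertion N R) [] (u @ inverse_word v)"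
    using assms by (simp add: kernel)
  from equivclp_nat_insertion_context[OF this, of "[]" v] have "equivclp (nat_insertion N R) v (u @ inverse_word v @ v)"
    by simp
  moreover have "equivclp (nat_insertion N R) u (u @ inverse_word v @ v)"
    using equivclp_nat_insertion_context[OF inverse_word_cancel[OF assms(2)], of u "[]"] by simp
  ultimately show "equivclp (nat_insertion N R) u v"
    by (meson equivclp_sym equivclp_trans)
qed (use eval_word_equivclp_nat_insertion[OF relator_val] assms in blast)

end

section \<open>Moves on elements and on words\<close>

definition substitute :: "nat list list \<Rightarrow> nat list \<Rightarrow> nat list" where
  "substitute ws w = concat (map (\<lambda>l. if even l then nth_default [] ws (l div 2)
     else inverse_word (nth_default [] ws (l div 2))) w)"

lemma substitute_simps [simp]:
  "substitute ws [] = []"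
  "substitute ws (l # w) = (if even l then nth_default [] ws (l div 2)
     else inverse_word (nth_default [] ws (l div 2))) @ substitute ws w"
  by (simp_all add: substitute_def)

text \<open>The flags select which moves are present: \<open>a\<close> allows the application of \<open>\<phi>\<close>, \<open>b\<close> allows
  conjugation, and \<open>t\<close> twists the conjugation by \<open>\<phi>\<close>.  With \<open>(a, b, t)\<close> equal to
  \<open>(False, True, True)\<close>, \<open>(True, False, False)\<close> and \<open>(True, True, False)\<close> the classes of the
  equivalence generated by the moves are the twisted conjugacy classes, the orbits of \<open>\<phi>\<close>, and the
  unions of the conjugacy classes that meet an orbit.\<close>

definition move :: "('a, 'b) monoid_scheme \<Rightarrow> bool \<Rightarrow> bool \<Rightarrow> bool \<Rightarrow> ('a \<Rightarrow> 'a) \<Rightarrow> 'a \<Rightarrow> 'a \<Rightarrow> bool" where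
  "move G a b t \<phi> x y \<longleftrightarrow> x \<in> carrier G \<and> (a \<and> y = \<phi> x \<or>
     b \<and> (\<exists>z \<in> carrier G. y = inv\<^bsub>G\<^esub> (if t then \<phi> z else z) \<otimes>\<^bsub>G\<^esub> x \<otimes>\<^bsub>G\<^esub> z))"

text \<open>Insertions are included, so that one relation between words accounts for the moves and for
  equality in the group.\<close>

definition word_move ::
  "nat \<Rightarrow> nat list set \<Rightarrow> bool \<Rightarrow> bool \<Rightarrow> bool \<Rightarrow> nat list list \<Rightarrow> nat list \<Rightarrow> nat list \<Rightarrow> bool" where
  "word_move N R a b t ws u v \<longleftrightarrow> nat_insertion N R u v \<or> u \<in> nat_words N \<and> (a \<and> v = substitute ws u \<or>
     b \<and> (\<exists>z. z \<in> nat_words N \<and> v = inverse_word (if t then substitute ws z else z) @ u @ z))"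

text \<open>The words \<open>ws\<close> represent the images of the generators, so substitution computes \<open>\<phi>\<close> on words.\<close>

locale presented_endo = presented_group +
  fixes \<phi> :: "'a \<Rightarrow> 'a" and ws :: "nat list list"
  assumes endo: "\<phi> \<in> hom G G"
    and images: "\<And>i. i < N \<Longrightarrow> nth_default [] ws i \<in> nat_words N \<and> val (nth_default [] ws i) = \<phi> (gen (2 * i))"
begin

lemma endo_closed [simp]: "x \<in> carrier G \<Longrightarrow> \<phi> x \<in> carrier G"
  using endo by (auto simp: hom_def)

lemma endo_mult: "x \<in> carrier G \<Longrightarrow> y \<in> carrier G \<Longrightarrow> \<phi> (x \<otimes> y) = \<phi> x \<otimes> \<phi> y"
  using endo by (auto simp: hom_def)

lemma endo_group_hom: "group_hom G G \<phi>"
  by (simp add: group_hom.intro group_hom_axioms.intro endo is_group)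

lemma substitute_val: "w \<in> nat_words N \<Longrightarrow> substitute ws w \<in> nat_words N \<and> val (substitute ws w) = \<phi> (val w)"
proof (induction w)
  case Nil
  then show ?case using group_hom.hom_one[OF endo_group_hom] by simp
next
  case (Cons l w)
  let ?u = "nth_default [] ws (l div 2)"
  have u: "?u \<in> nat_words N" "val ?u = \<phi> (gen (2 * (l div 2)))"
    using images[of "l div 2"] Cons.prems by auto
  have l: "l < N + N" using Cons.prems by simp
  show ?case
  proof (cases "even l")
    case True
    with u Cons l show ?thesis by (simp add: eval_word_append endo_mult gen_closed)
  next
    case False
    then have f: "2 * (l div 2) = flip l" by (simp add: flip_def)
    then have "inv (\<phi> (gen (2 * (l div 2)))) = \<phi> (gen l)"
      using l gen_flip_inv[OF flip_less[OF l]] group_hom.hom_inv[OF endo_group_hom]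
      by (simp add: gen_closed flip_less)
    with False u Cons l show ?thesis by (simp add: eval_word_append eval_word_inverse_word endo_mult gen_closed)
  qed
qed

lemma move_closed: "move G a b t \<phi> x y \<Longrightarrow> y \<in> carrier G"
  by (auto simp: move_def)

lemma word_move_val:
  assumes "word_move N R a b t ws u v" "u \<in> nat_words N \<or> v \<in> nat_words N"
  shows "u \<in> nat_words N \<and> v \<in> nat_words N \<and> (val u = val v \<or> move G a b t \<phi> (val u) (val v))"
proof (cases "nat_insertion N R u v")
  case True
  then have "u \<in> nat_words N" "v \<in> nat_words N" using assms(2) nat_insertion_nat_words[OF relators] by blast+
  with True show ?thesis using val_eq_iff equivclp_base by metis
next
  case False
  with assms(1) have u: "u \<in> nat_words N" and
    v: "a \<and> v = substitute ws u \<or> b \<and> (\<exists>z. z \<in> nat_words N \<and> v = inverse_word (if t then substitute ws z else z) @ u @ z)"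
    by (auto simp: word_move_def)
  from v show ?thesis
  proof (elim disjE conjE exE)
    assume "a" "v = substitute ws u"
    then show ?thesis using u substitute_val by (simp add: move_def)
  next
    fix z assume z: "b" "z \<in> nat_words N" "v = inverse_word (if t then substitute ws z else z) @ u @ z"
    then have "v \<in> nat_words N" "val v = inv (if t then \<phi> (val z) else val z) \<otimes> val u \<otimes> val z"
      using u substitute_val by (auto simp: eval_word_append eval_word_inverse_word m_assoc)
    then show ?thesis using u z(1,2) by (auto simp: move_def)
  qed
qed

lemma move_lifts:
  assumes "move G a b t \<phi> (val u) y" "u \<in> nat_words N"
  shows "\<exists>v \<in> nat_words N. word_move N R a b t ws u v \<and> val v = y"
  using assms(1) unfolding move_def
proof (elim disjE conjE bexE)
  assume "a" "y = \<phi> (val u)"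
  then show ?thesis using assms(2) substitute_val by (intro bexI[of _ "substitute ws u"]) (auto simp: word_move_def)
next
  fix z assume z: "b" "z \<in> carrier G" "y = inv (if t then \<phi> z else z) \<otimes> val u \<otimes> z"
  obtain w where w: "w \<in> nat_words N" "val w = z" using val_cases z(2) by blast
  then show ?thesis using assms(2) substitute_val z
    by (intro bexI[of _ "inverse_word (if t then substitute ws w else w) @ u @ w"])
      (auto simp: word_move_def eval_word_append eval_word_inverse_word m_assoc)
qed

text \<open>Each word move projects to a move or to an equality.  Conversely a chain of moves is lifted one step
  at a time: a step can be lifted to the word reached so far, and the word obtained agrees in the
  group with any other representative, hence is linked to it by insertions.\<close>

theorem equivclp_word_move:
  assumes u: "u \<in> nat_words N" and v: "v \<in> nat_words N"
  shows "equivclp (word_move N R a b t ws) u v \<longleftrightarrow> equivclp (move G a b t \<phi>) (val u) (val v)"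
proof
  assume "equivclp (word_move N R a b t ws) u v"
  then have "v \<in> nat_words N \<and> equivclp (move G a b t \<phi>) (val u) (val v)"
  proof (induction rule: equivclp_induct)
    case (step y z)
    then have "z \<in> nat_words N \<and> equivclp (move G a b t \<phi>) (val y) (val z)"
      using word_move_val[of a b t y z] word_move_val[of a b t z y]
      by (metis equivclp_base equivclp_refl equivclp_sym)
    with step show ?case by (metis equivclp_trans)
  qed (use u in simp)
  then show "equivclp (move G a b t \<phi>) (val u) (val v)" ..
next
  let ?W = "word_move N R a b t ws"
  have same: "equivclp ?W u' v'" if "u' \<in> nat_words N" "v' \<in> nat_words N" "val u' = val v'" for u' v'
  proof -
    have "equivclp (nat_insertion N R) u' v'" using that val_eq_iff by blast
    then show ?thesis
      by (rule equivclp_map[where f = "\<lambda>x. x"]) (auto intro: equivclp_base simp: word_move_def)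
  qed
  assume "equivclp (move G a b t \<phi>) (val u) (val v)"
  then have "val v \<in> carrier G \<and> (\<forall>w \<in> nat_words N. val w = val v \<longrightarrow> equivclp ?W u w)"
  proof (induction rule: equivclp_induct)
    case base
    then show ?case using u same by simp
  next
    case (step y z)
    then obtain u' where u': "u' \<in> nat_words N" "val u' = y" "equivclp ?W u u'"
      using val_cases by blast
    from step(2) show ?case
    proof
      assume "move G a b t \<phi> y z"
      then obtain v' where "v' \<in> nat_words N" "?W u' v'" "val v' = z"
        using move_lifts u' by blast
      then show ?thesis using u' same[of v'] by (metis equivclp_base equivclp_trans eval_word_closed)
    next
      assume zy: "move G a b t \<phi> z y"
      have "equivclp ?W u w" if w: "w \<in> nat_words N" "val w = z" for w
      proof -
        obtain v' where "v' \<in> nat_words N" "?W w v'" "val v' = y"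
          using move_lifts zy w by blast
        then have "equivclp ?W w v'" "equivclp ?W v' u'"
          using u' same by (auto intro: equivclp_base)
        with u' show ?thesis by (meson equivclp_sym equivclp_trans)
      qed
      then show ?thesis using zy by (auto simp: move_def)
    qed
  qed
  then show "equivclp ?W u v" using v by blast
qed

end

section \<open>Twisted conjugacy classes and orbits as classes of moves\<close>

lemma (in group) auto_facts:
  assumes "\<phi> \<in> auto G"
  shows "\<phi> \<in> hom G G" "x \<in> carrier G \<Longrightarrow> \<phi> x \<in> carrier G"
    "x \<in> carrier G \<Longrightarrow> y \<in> carrier G \<Longrightarrow> \<phi> (x \<otimes> y) = \<phi> x \<otimes> \<phi> y"
    "x \<in> carrier G \<Longrightarrow> \<phi> (inv x) = inv (\<phi> x)"
    "\<phi> ` carrier G = carrier G"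
proof -
  show hom: "\<phi> \<in> hom G G" using assms by (simp add: auto_def)
  then show "x \<in> carrier G \<Longrightarrow> \<phi> x \<in> carrier G"
    "x \<in> carrier G \<Longrightarrow> y \<in> carrier G \<Longrightarrow> \<phi> (x \<otimes> y) = \<phi> x \<otimes> \<phi> y"
    by (auto simp: hom_def)
  show "x \<in> carrier G \<Longrightarrow> \<phi> (inv x) = inv (\<phi> x)"
    using group_hom.hom_inv[of G G \<phi> x] hom is_group by (simp add: group_hom_def group_hom_axioms_def)
  show "\<phi> ` carrier G = carrier G" using assms by (simp add: auto_def Bij_def bij_betw_def)
qed

context group
begin

text \<open>Twisted conjugations compose and invert, so a chain of moves collapses to a single one.\<close>

lemma twisted_conj_iff:
  assumes "\<phi> \<in> auto G" "x \<in> carrier G"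
  shows "equivclp (move G False True True \<phi>) x y \<longleftrightarrow> (\<exists>z \<in> carrier G. y = inv (\<phi> z) \<otimes> x \<otimes> z)"
proof
  note [simp] = auto_facts(2-4)[OF assms(1)]
  assume "equivclp (move G False True True \<phi>) x y"
  then show "\<exists>z \<in> carrier G. y = inv (\<phi> z) \<otimes> x \<otimes> z"
  proof (induction rule: equivclp_induct)
    case base
    show ?case using assms group_hom.hom_one[of G G \<phi>] auto_facts(1)[OF assms(1)] is_group
      by (intro bexI[of _ \<one>]) (simp_all add: group_hom_def group_hom_axioms_def)
  next
    case (step y v)
    then obtain z where z: "z \<in> carrier G" "y = inv (\<phi> z) \<otimes> x \<otimes> z" by blast
    from step(2) show ?case
    proof
      assume "move G False True True \<phi> y v"
      then obtain w where w: "w \<in> carrier G" "v = inv (\<phi> w) \<otimes> y \<otimes> w"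
        by (auto simp: move_def)
      with z assms(2) show ?thesis
        by (intro bexI[of _ "z \<otimes> w"]) (simp_all add: inv_mult_group m_assoc)
    next
      assume "move G False True True \<phi> v y"
      then obtain w where w: "w \<in> carrier G" "v \<in> carrier G" "y = inv (\<phi> w) \<otimes> v \<otimes> w"
        by (auto simp: move_def)
      have "v = \<phi> w \<otimes> y \<otimes> inv w"
        unfolding w(3) using w(1,2) by (simp add: m_assoc) (simp add: m_assoc[symmetric])
      then show ?thesis using z w(1) assms(2)
        by (intro bexI[of _ "z \<otimes> inv w"]) (simp_all add: inv_mult_group m_assoc)
    qed
  qed
next
  assume "\<exists>z \<in> carrier G. y = inv (\<phi> z) \<otimes> x \<otimes> z"
  then have "move G False True True \<phi> x y" using assms(2) by (auto simp: move_def)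
  then show "equivclp (move G False True True \<phi>) x y" by (rule equivclp_base)
qed

abbreviation auto_pow :: "('a \<Rightarrow> 'a) \<Rightarrow> int \<Rightarrow> 'a \<Rightarrow> 'a" where
  "auto_pow \<phi> k \<equiv> \<phi> [^]\<^bsub>AutoGroup G\<^esub> k"

lemma auto_pow:
  assumes "\<phi> \<in> auto G"
  shows "auto_pow \<phi> k \<in> auto G"
    "x \<in> carrier G \<Longrightarrow> auto_pow \<phi> 0 x = x"
    "x \<in> carrier G \<Longrightarrow> auto_pow \<phi> 1 x = \<phi> x"
    "x \<in> carrier G \<Longrightarrow> auto_pow \<phi> (j + k) x = auto_pow \<phi> j (auto_pow \<phi> k x)"
proof -
  interpret A: group "AutoGroup G" by (rule AutoGroup)
  have carrier: "carrier (AutoGroup G) = auto G" by (simp add: AutoGroup_def)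
  show pow: "auto_pow \<phi> k \<in> auto G" for k :: int
    using A.int_pow_closed[of \<phi> k] assms carrier by simp
  show "x \<in> carrier G \<Longrightarrow> auto_pow \<phi> 0 x = x"
    by (simp add: AutoGroup_def BijGroup_def)
  show "x \<in> carrier G \<Longrightarrow> auto_pow \<phi> 1 x = \<phi> x"
    using A.int_pow_1[of \<phi>] assms carrier by simp
  have "auto_pow \<phi> (j + k) = auto_pow \<phi> j \<otimes>\<^bsub>AutoGroup G\<^esub> auto_pow \<phi> k"
    using A.int_pow_mult[of \<phi> j k] assms carrier by simp
  also have "\<dots> = compose (carrier G) (auto_pow \<phi> j) (auto_pow \<phi> k)"
    using pow by (simp add: AutoGroup_def BijGroup_def auto_def)
  finally show "x \<in> carrier G \<Longrightarrow> auto_pow \<phi> (j + k) x = auto_pow \<phi> j (auto_pow \<phi> k x)"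
    by (simp add: compose_eq)
qed

lemma auto_pow_back:
  assumes "\<phi> \<in> auto G" "x \<in> carrier G"
  shows "auto_pow \<phi> (- 1) (\<phi> x) = x"
  using auto_pow(4)[OF assms, of "- 1" 1] auto_pow(2,3)[OF assms] by simp

text \<open>Negative powers are reached as well, because the generated equivalence is symmetric: \<open>n\<close> applications
  of \<open>\<phi>\<close> lead from \<open>\<phi>\<^sup>-\<^sup>n x\<close> to \<open>x\<close>.\<close>

lemma equivclp_auto_pow:
  assumes "\<phi> \<in> auto G" "x \<in> carrier G"
  shows "equivclp (move G True b t \<phi>) x (auto_pow \<phi> k x)"
proof -
  note closed = auto_facts(2)[OF auto_pow(1)[OF assms(1)]]
  have nat: "equivclp (move G True b t \<phi>) x (auto_pow \<phi> (int n) x)" if "x \<in> carrier G" for n x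
  proof (induction n)
    case (Suc n)
    have "auto_pow \<phi> (int (Suc n)) x = \<phi> (auto_pow \<phi> (int n) x)"
      using auto_pow(4)[OF assms(1) that, of 1 "int n"] auto_pow(3)[OF assms(1) closed[OF that]]
      by simp
    then have "move G True b t \<phi> (auto_pow \<phi> (int n) x) (auto_pow \<phi> (int (Suc n)) x)"
      using closed[OF that] by (simp add: move_def)
    with Suc show ?case by (blast intro: equivclp_base equivclp_trans)
  qed (use that auto_pow(2)[OF assms(1)] in simp)
  show ?thesis
  proof (cases "k \<ge> 0")
    case True
    then show ?thesis using nat[OF assms(2), of "nat k"] by simp
  next
    case False
    have "auto_pow \<phi> (- k) (auto_pow \<phi> k x) = x"
      using auto_pow(4)[OF assms, of "- k" k] auto_pow(2)[OF assms] by simp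
    with nat[OF closed[OF assms(2)], of k "nat (- k)"] False show ?thesis
      by (simp add: equivclp_sym)
  qed
qed

lemma orbit_iff:
  assumes "\<phi> \<in> auto G" "x \<in> carrier G"
  shows "equivclp (move G True False False \<phi>) x y \<longleftrightarrow> (\<exists>k. y = auto_pow \<phi> k x)"
proof
  note closed = auto_facts(2)[OF auto_pow(1)[OF assms(1)]]
  assume "equivclp (move G True False False \<phi>) x y"
  then show "\<exists>k. y = auto_pow \<phi> k x"
  proof (induction rule: equivclp_induct)
    case base
    show ?case using auto_pow(2)[OF assms] by metis
  next
    case (step y v)
    then obtain k where k: "y = auto_pow \<phi> k x" by blast
    from step(2) have "v = auto_pow \<phi> 1 y \<or> v = auto_pow \<phi> (- 1) y"
      using auto_pow_back[OF assms(1)] auto_pow(3)[OF assms(1)] by (auto simp: move_def)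
    then show ?case using k auto_pow(4)[OF assms] by metis
  qed
qed (use equivclp_auto_pow[OF assms] in auto)

text \<open>An automorphism carries conjugates to conjugates, so in a chain of moves all applications of
  \<open>\<phi>\<^sup>\<plusminus>\<^sup>1\<close> can be performed before a single conjugation.\<close>

lemma conj_orbit_iff:
  assumes "\<phi> \<in> auto G" "x \<in> carrier G"
  shows "equivclp (move G True True False \<phi>) x y \<longleftrightarrow>
    (\<exists>k. \<exists>z \<in> carrier G. y = inv z \<otimes> auto_pow \<phi> k x \<otimes> z)"
proof
  note closed [simp] = auto_facts(2)[OF auto_pow(1)[OF assms(1)]]
  note pow = auto_facts(3,4)[OF auto_pow(1)[OF assms(1)]]
  assume "equivclp (move G True True False \<phi>) x y"
  then show "\<exists>k. \<exists>z \<in> carrier G. y = inv z \<otimes> auto_pow \<phi> k x \<otimes> z"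
  proof (induction rule: equivclp_induct)
    case base
    show ?case using assms(2) auto_pow(2)[OF assms] by (intro exI[of _ 0] bexI[of _ \<one>]) simp_all
  next
    case (step y v)
    then obtain k z where z: "z \<in> carrier G" "y = inv z \<otimes> auto_pow \<phi> k x \<otimes> z" by blast
    have shift: "auto_pow \<phi> j y = inv (auto_pow \<phi> j z) \<otimes> auto_pow \<phi> (j + k) x \<otimes> auto_pow \<phi> j z" for j
      using z assms(2) auto_pow(4)[OF assms] by (simp add: pow)
    from step(2) consider j where "v = auto_pow \<phi> j y"
      | w where "w \<in> carrier G" "v = inv w \<otimes> y \<otimes> w"
    proof
      assume "move G True True False \<phi> y v"
      then consider "y \<in> carrier G" "v = \<phi> y" | w where "w \<in> carrier G" "v = inv w \<otimes> y \<otimes> w"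
        by (auto simp: move_def)
      then show thesis using that auto_pow(3)[OF assms(1)] by metis
    next
      assume "move G True True False \<phi> v y"
      then consider "v \<in> carrier G" "y = \<phi> v" | w where "v \<in> carrier G" "w \<in> carrier G" "y = inv w \<otimes> v \<otimes> w"
        by (auto simp: move_def)
      then show thesis
      proof cases
        case 1
        then show thesis using that(1) auto_pow_back[OF assms(1)] by metis
      next
        case 2
        have "v = inv (inv w) \<otimes> y \<otimes> inv w"
          unfolding 2(3) using 2(1,2) by (simp add: m_assoc) (simp add: m_assoc[symmetric])
        then show thesis using that(2) 2 by blast
      qed
    qed
    then show ?case
    proof cases
      case 1
      then show ?thesis using shift z(1) by (intro exI[of _ "j + k"] bexI[of _ "auto_pow \<phi> j z"]) simp_all
    next
      case 2
      then show ?thesis using z assms(2)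
        by (intro exI[of _ k] bexI[of _ "z \<otimes> w"]) (simp_all add: inv_mult_group m_assoc)
    qed
  qed
next
  assume "\<exists>k. \<exists>z \<in> carrier G. y = inv z \<otimes> auto_pow \<phi> k x \<otimes> z"
  then obtain k z where z: "z \<in> carrier G" "y = inv z \<otimes> auto_pow \<phi> k x \<otimes> z" by blast
  then have "move G True True False \<phi> (auto_pow \<phi> k x) y"
    using auto_facts(2)[OF auto_pow(1)[OF assms(1)] assms(2)] by (auto simp: move_def)
  then show "equivclp (move G True True False \<phi>) x y"
    using equivclp_auto_pow[OF assms] by (blast intro: equivclp_base equivclp_trans)
qed

definition saturation :: "('a \<Rightarrow> 'a \<Rightarrow> bool) \<Rightarrow> 'a set \<Rightarrow> 'a set" where
  "saturation r K = {x \<in> carrier G. \<exists>s \<in> K. equivclp r x s}"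

lemma TCC_saturation:
  assumes "\<phi> \<in> auto G" "K \<subseteq> carrier G"
  shows "TCC G \<phi> K = saturation (move G False True True \<phi>) K"
proof -
  have "x \<in> TCC G \<phi> K \<longleftrightarrow> x \<in> carrier G \<and> (\<exists>s \<in> K. equivclp (move G False True True \<phi>) s x)" for x
    using assms(2) by (auto simp: TCC_def twisted_conj_iff[OF assms(1) subsetD[OF assms(2)]]
        auto_facts[OF assms(1)]) (metis auto_facts(4)[OF assms(1)])+
  then show ?thesis by (auto simp: saturation_def dest: equivclp_sym)
qed

lemma auto_orbit_saturation:
  assumes "\<phi> \<in> auto G" "K \<subseteq> carrier G"
  shows "auto_orbit G \<phi> K = saturation (move G True False False \<phi>) K"
proof -
  have "x \<in> auto_orbit G \<phi> K \<longleftrightarrow> x \<in> carrier G \<and> (\<exists>s \<in> K. equivclp (move G True False False \<phi>) s x)" for x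
    using assms(2) auto_facts(2)[OF auto_pow(1)[OF assms(1)]]
    by (auto simp: auto_orbit_def orbit_iff[OF assms(1) subsetD[OF assms(2)]])
  then show ?thesis by (auto simp: saturation_def dest: equivclp_sym)
qed

lemma BCC_saturation:
  assumes "\<phi> \<in> auto G" "K \<subseteq> carrier G"
  shows "BCC G \<phi> K = saturation (move G True True False \<phi>) K"
proof -
  have "x \<in> BCC G \<phi> K \<longleftrightarrow> x \<in> carrier G \<and> (\<exists>s \<in> K. equivclp (move G True True False \<phi>) s x)" for x
    using assms(2) auto_facts(2)[OF auto_pow(1)[OF assms(1)]]
    by (auto simp: BCC_def auto_orbit_def conj_orbit_iff[OF assms(1) subsetD[OF assms(2)]])
  then show ?thesis by (auto simp: saturation_def dest: equivclp_sym)
qed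

end

section \<open>Finite quotients from separability\<close>

text \<open>The finite-index right cosets form only a subbasis by definition.  They are in fact a basis, since the
  intersection of two subgroups of finite index has finite index.\<close>

lemma (in group) separable_coset:
  assumes "separable G S" "x \<in> carrier G" "x \<notin> S"
  obtains H where "subgroup H G" "finite (rcosets H)" "(H #> x) \<inter> S = {}"
proof -
  let ?B = "\<Union>H \<in> {H. subgroup H G \<and> finite (rcosets H)}. rcosets H"
  have nbhd: "\<forall>x \<in> U. x \<in> carrier G \<and> (\<exists>H. subgroup H G \<and> finite (rcosets H) \<and> (H #> x) \<subseteq> U)"
    if "generate_topology_on ?B U" for U
    using that
  proof (induction rule: generate_topology_on.induct)
    case (Int U V)
    show ?case
    proof
      fix x assume x: "x \<in> U \<inter> V"
      then obtain H K where H: "subgroup H G" "finite (rcosets H)" "(H #> x) \<subseteq> U"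
        and K: "subgroup K G" "finite (rcosets K)" "(K #> x) \<subseteq> V"
        using Int.IH by blast
      have coset: "(H \<inter> K) #> g = (H #> g) \<inter> (K #> g)" if "g \<in> carrier G" for g
        using that subgroup.mem_carrier[OF H(1)] subgroup.mem_carrier[OF K(1)]
        by (auto simp: r_coset_def)
      then have "rcosets (H \<inter> K) \<subseteq> (\<lambda>(A, B). A \<inter> B) ` ((rcosets H) \<times> (rcosets K))"
        by (auto simp: RCOSETS_def)
      then have "finite (rcosets (H \<inter> K))"
        using H(2) K(2) finite_subset by blast
      moreover have "subgroup (H \<inter> K) G"
        using H(1) K(1) by (rule subgroups_Inter_pair)
      moreover have "x \<in> carrier G" using x Int.IH by blast
      ultimately show "x \<in> carrier G \<and> (\<exists>H. subgroup H G \<and> finite (rcosets H) \<and> (H #> x) \<subseteq> U \<inter> V)"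
        using H(3) K(3) coset by blast
    qed
  next
    case (Basis C)
    then obtain H where H: "subgroup H G" "finite (rcosets H)" "C \<in> rcosets H" by blast
    show ?case
    proof
      fix x assume "x \<in> C"
      obtain a where a: "a \<in> carrier G" "C = H #> a" using H(3) by (auto simp: RCOSETS_def)
      with \<open>x \<in> C\<close> have "H #> x = C" "x \<in> carrier G"
        using repr_independence[OF _ _ H(1)] r_coset_subset_G[OF subgroup.subset[OF H(1)]] by blast+
      with H show "x \<in> carrier G \<and> (\<exists>H. subgroup H G \<and> finite (rcosets H) \<and> (H #> x) \<subseteq> C)"
        by blast
    qed
  qed blast+
  have "rcosets (carrier G) = {carrier G}"
    using coset_join2[OF _ subgroup_self] one_closed by (auto simp: RCOSETS_def)
  then have "carrier G \<in> ?B" using subgroup_self by force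
  then have "x \<in> topspace (profinite_topology G)"
    using assms(2) by (auto simp: profinite_topology_def topology_generated_by_topspace)
  moreover have "openin (profinite_topology G) (topspace (profinite_topology G) - S)"
    using assms(1) by (simp add: separable_def closedin_def)
  ultimately obtain H where "subgroup H G" "finite (rcosets H)"
      "(H #> x) \<subseteq> topspace (profinite_topology G) - S"
    using nbhd assms(3) unfolding profinite_topology_def openin_topology_generated_by_iff by blast
  then show thesis using that by blast
qed

text \<open>Translating by \<open>inv g\<close> turns the right translations of the coset space into a left action, as
  needed for a homomorphism to the group of bijections under composition.\<close>

lemma (in group) coset_action_hom:
  assumes "subgroup H G"
  shows "(\<lambda>g. \<lambda>C \<in> rcosets H. C #> inv g) \<in> hom G (BijGroup (rcosets H))"
proof -
  let ?\<rho> = "\<lambda>g. \<lambda>C \<in> rcosets H. C #> inv g"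
  have sub: "H \<subseteq> carrier G" using assms by (rule subgroup.subset)
  have closed: "C #> g \<in> rcosets H" if "C \<in> rcosets H" "g \<in> carrier G" for C g
    using that sub by (auto simp: RCOSETS_def coset_mult_assoc)
  have carr: "C \<subseteq> carrier G" if "C \<in> rcosets H" for C
    using that subgroup.rcosets_carrier[OF assms is_group] by simp
  have Bij: "?\<rho> g \<in> Bij (rcosets H)" if "g \<in> carrier G" for g
  proof -
    have "bij_betw (\<lambda>C. C #> inv g) (rcosets H) (rcosets H)"
      by (rule bij_betw_byWitness[where f' = "\<lambda>C. C #> g"])
        (use that closed carr in \<open>auto simp: coset_mult_assoc\<close>)
    then show ?thesis by (simp add: Bij_def)
  qed
  show ?thesis
  proof (rule homI)
    fix g h assume gh: "g \<in> carrier G" "h \<in> carrier G"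
    have "?\<rho> (g \<otimes> h) = compose (rcosets H) (?\<rho> g) (?\<rho> h)"
      using gh closed carr by (auto simp: compose_def coset_mult_assoc inv_mult_group fun_eq_iff)
    then show "?\<rho> (g \<otimes> h) = ?\<rho> g \<otimes>\<^bsub>BijGroup (rcosets H)\<^esub> ?\<rho> h"
      using Bij gh by (simp add: BijGroup_def)
  qed (use Bij in \<open>simp add: BijGroup_def\<close>)
qed

lemma (in presented_group) hom_determined_by_generators:
  assumes "group F" "\<rho> \<in> hom G F" "\<rho>' \<in> hom G F" "\<And>l. l < N + N \<Longrightarrow> \<rho> (gen l) = \<rho>' (gen l)"
    and "x \<in> carrier G"
  shows "\<rho> x = \<rho>' x"
proof -
  interpret r: group_hom G F \<rho> using assms by (simp add: group_hom_def group_hom_axioms_def is_group)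
  interpret r': group_hom G F \<rho>' using assms by (simp add: group_hom_def group_hom_axioms_def is_group)
  have "\<rho> (val w) = \<rho>' (val w)" if "w \<in> nat_words N" for w
    using that by (induction w) (simp_all add: gen_closed assms(4))
  then show ?thesis using val_cases[OF assms(5)] by blast
qed

text \<open>The point \<open>e\<close> receives the number \<open>0\<close> because multiplication tables have their identity there.\<close>

lemma finite_image_numbering:
  fixes \<Psi> :: "'a \<Rightarrow> 'c"
  assumes "finite (\<Psi> ` A)" "e \<in> A"
  obtains m :: nat and \<theta> where "\<theta> ` A = {..<m}" "\<theta> e = 0"
    "\<And>x y. x \<in> A \<Longrightarrow> y \<in> A \<Longrightarrow> \<theta> x = \<theta> y \<longleftrightarrow> \<Psi> x = \<Psi> y"
proof -
  obtain m h where h: "bij_betw h (\<Psi> ` A) {..<m::nat}"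
    using ex_bij_betw_finite_nat[OF assms(1)] by (auto simp: atLeast0LessThan)
  \<comment> \<open>Swaps the number of \<open>e\<close> with \<open>0\<close>.\<close>
  define s where "s i = (if i = h (\<Psi> e) then 0 else if i = 0 then h (\<Psi> e) else i)" for i
  have he: "h (\<Psi> e) < m" using h assms(2) by (auto simp: bij_betw_def)
  have "bij_betw s {..<m} {..<m}"
    by (rule bij_betw_byWitness[where f' = s]) (use he in \<open>auto simp: s_def\<close>)
  from bij_betw_trans[OF h this] have b: "bij_betw (s \<circ> h) (\<Psi> ` A) {..<m}" .
  show thesis
  proof (rule that[of "\<lambda>x. (s \<circ> h) (\<Psi> x)" m])
    show "(\<lambda>x. (s \<circ> h) (\<Psi> x)) ` A = {..<m}"
      using b by (simp add: bij_betw_def image_image)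
    show "(s \<circ> h) (\<Psi> e) = 0" by (simp add: s_def)
    show "(s \<circ> h) (\<Psi> x) = (s \<circ> h) (\<Psi> y) \<longleftrightarrow> \<Psi> x = \<Psi> y" if "x \<in> A" "y \<in> A" for x y
      using b that by (auto simp: bij_betw_def inj_on_def)
  qed
qed

text \<open>Separability gives a subgroup \<open>H\<close> of finite index with \<open>H x\<close> disjoint from \<open>S\<close>, but the
  corresponding finite quotient need not be compatible with \<open>\<phi>\<close>.  Therefore all homomorphisms from
  \<open>G\<close> to the symmetric group of the coset space are used at once, and two elements are identified
  when no such homomorphism tells them apart.  This congruence respects \<open>\<phi>\<close>, because composing a
  homomorphism with \<open>\<phi>\<close> gives another one.  It has finitely many classes, because homomorphisms on
  a finitely generated group are determined by finitely many values.  It separates \<open>x\<close> from \<open>S\<close>,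
  because the action on the cosets is among the homomorphisms.\<close>

theorem (in presented_group) separating_finite_quotient:
  assumes "separable G S" "x \<in> carrier G" "x \<notin> S" "\<phi> \<in> hom G G"
  obtains m :: nat and \<theta> where "\<theta> ` carrier G = {..<m}" "\<theta> \<one> = 0"
    "\<forall>g \<in> carrier G. \<forall>g' \<in> carrier G. \<forall>h \<in> carrier G. \<forall>h' \<in> carrier G.
       \<theta> g = \<theta> g' \<longrightarrow> \<theta> h = \<theta> h' \<longrightarrow> \<theta> (g \<otimes> h) = \<theta> (g' \<otimes> h')"
    "\<forall>g \<in> carrier G. \<forall>g' \<in> carrier G. \<theta> g = \<theta> g' \<longrightarrow> \<theta> (\<phi> g) = \<theta> (\<phi> g')"
    "\<forall>s \<in> S \<inter> carrier G. \<theta> s \<noteq> \<theta> x"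
proof -
  obtain H where H: "subgroup H G" "finite (rcosets H)" "(H #> x) \<inter> S = {}"
    using separable_coset assms(1-3) by blast
  define F where "F = BijGroup (rcosets H)"
  interpret F: group F unfolding F_def by (rule group_BijGroup)
  have "finite (carrier F)"
  proof (rule finite_subset)
    show "carrier F \<subseteq> (\<Pi>\<^sub>E C \<in> rcosets H. rcosets H)"
      by (auto simp: F_def BijGroup_def Bij_def bij_betw_def PiE_def)
    show "finite (\<Pi>\<^sub>E C \<in> rcosets H. rcosets H)"
      using H(2) by (intro finite_PiE) auto
  qed
  \<comment> \<open>The values at the letters determine a homomorphism, so \<open>L\<close> enumerates all of them.\<close>
  define key where "key \<rho> = map (\<lambda>l. \<rho> (gen l)) [0..<N + N]" for \<rho> :: "'a \<Rightarrow> 'a set \<Rightarrow> 'a set"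
  define L where "L = key ` hom G F"
  define rep where "rep k = (SOME \<rho>. \<rho> \<in> hom G F \<and> key \<rho> = k)" for k
  have rep: "rep (key \<rho>) \<in> hom G F" "key (rep (key \<rho>)) = key \<rho>" if "\<rho> \<in> hom G F" for \<rho>
    using someI[of "\<lambda>\<sigma>. \<sigma> \<in> hom G F \<and> key \<sigma> = key \<rho>" \<rho>] that by (simp_all add: rep_def)
  have agree: "rep (key \<rho>) g = \<rho> g" if "\<rho> \<in> hom G F" "g \<in> carrier G" for \<rho> g
    using hom_determined_by_generators[OF F.is_group rep(1)[OF that(1)] that(1) _ that(2)] rep(2)[OF that(1)]
    by (simp add: key_def map_eq_conv)
  have "L \<subseteq> {ks. set ks \<subseteq> carrier F \<and> length ks = N + N}"
    by (auto simp: L_def key_def hom_def gen_closed Pi_def)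
  then have "finite L"
    using finite_lists_length_eq[OF \<open>finite (carrier F)\<close>] finite_subset by blast
  define \<Psi> where "\<Psi> g = (\<lambda>k \<in> L. rep k g)" for g
  have \<Psi>: "\<Psi> g = \<Psi> h \<longleftrightarrow> (\<forall>\<rho> \<in> hom G F. \<rho> g = \<rho> h)" if "g \<in> carrier G" "h \<in> carrier G" for g h
  proof -
    have "\<Psi> g = \<Psi> h \<longleftrightarrow> (\<forall>k \<in> L. rep k g = rep k h)"
      by (auto simp: \<Psi>_def restrict_def fun_eq_iff)
    also have "\<dots> \<longleftrightarrow> (\<forall>\<rho> \<in> hom G F. \<rho> g = \<rho> h)"
      using agree that by (simp add: L_def)
    finally show ?thesis .
  qed
  have "\<Psi> ` carrier G \<subseteq> (\<Pi>\<^sub>E k \<in> L. carrier F)"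
    by (auto simp: \<Psi>_def L_def intro!: hom_in_carrier[OF rep(1)])
  moreover have "finite (\<Pi>\<^sub>E k \<in> L. carrier F)"
    using \<open>finite L\<close> \<open>finite (carrier F)\<close> by (intro finite_PiE) auto
  ultimately have "finite (\<Psi> ` carrier G)" by (rule finite_subset)
  from finite_image_numbering[OF this one_closed]
  obtain m :: nat and \<theta> where \<theta>: "\<theta> ` carrier G = {..<m}" "\<theta> \<one> = 0"
    "\<And>x y. x \<in> carrier G \<Longrightarrow> y \<in> carrier G \<Longrightarrow> \<theta> x = \<theta> y \<longleftrightarrow> \<Psi> x = \<Psi> y"
    by metis
  have iff: "\<theta> g = \<theta> h \<longleftrightarrow> (\<forall>\<rho> \<in> hom G F. \<rho> g = \<rho> h)" if "g \<in> carrier G" "h \<in> carrier G" for g h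
    using \<theta>(3) \<Psi> that by blast
  show thesis
  proof (rule that[OF \<theta>(1,2)]; intro ballI impI)
    fix g g' h h' assume "g \<in> carrier G" "h \<in> carrier G" "g' \<in> carrier G" "h' \<in> carrier G"
      "\<theta> g = \<theta> g'" "\<theta> h = \<theta> h'"
    then show "\<theta> (g \<otimes> h) = \<theta> (g' \<otimes> h')" by (simp add: iff hom_mult)
  next
    fix g g' assume g: "g \<in> carrier G" "g' \<in> carrier G" "\<theta> g = \<theta> g'"
    have "\<rho> (\<phi> g) = \<rho> (\<phi> g')" if "\<rho> \<in> hom G F" for \<rho>
    proof -
      have "compose (carrier G) \<rho> \<phi> \<in> hom G F" using hom_compose[OF assms(4) that] .
      then have "compose (carrier G) \<rho> \<phi> g = compose (carrier G) \<rho> \<phi> g'" using g iff by blast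
      then show ?thesis using g by (simp add: compose_eq)
    qed
    then show "\<theta> (\<phi> g) = \<theta> (\<phi> g')"
      using g iff hom_in_carrier[OF assms(4)] by simp
  next
    fix s assume "s \<in> S \<inter> carrier G"
    then have s: "s \<in> S" "s \<in> carrier G" by simp_all
    show "\<theta> s \<noteq> \<theta> x"
    proof
      assume "\<theta> s = \<theta> x"
      then have *: "\<rho> s = \<rho> x" if "\<rho> \<in> hom G F" for \<rho> using iff s assms(2) that by blast
      have hom: "group_hom G F (\<lambda>g. \<lambda>C \<in> rcosets H. C #> inv g)"
        using coset_action_hom[OF H(1)] F.is_group is_group
        by (simp add: F_def group_hom_def group_hom_axioms_def)
      have "(\<lambda>C \<in> rcosets H. C #> inv (inv s)) = (\<lambda>C \<in> rcosets H. C #> inv (inv x))"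
        using group_hom.hom_inv[OF hom s(2)] group_hom.hom_inv[OF hom assms(2)]
          *[OF group_hom.homh[OF hom]] by simp
      from fun_cong[OF this, of H] have "H #> s = H #> x"
        using s assms(2) subgroup.subgroup_in_rcosets[OF H(1) is_group] by simp
      then have "s \<in> H #> x" using rcos_self[OF s(2) H(1)] by simp
      then show False using H(3) s by blast
    qed
  qed
qed

section \<open>Refutation in a finite quotient\<close>

definition table_mult :: "nat list list \<Rightarrow> nat \<Rightarrow> nat \<Rightarrow> nat" where
  "table_mult T i j = nth_default 0 (nth_default [] T i) j"

definition table_eval :: "nat list list \<Rightarrow> nat list \<Rightarrow> nat list \<Rightarrow> nat" where
  "table_eval T as w = foldr (\<lambda>l. table_mult T (nth_default 0 as l)) w 0"

text \<open>The group axioms for a table, with bounded quantifiers only, so that they can be checked.\<close>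

definition is_table :: "nat list list \<Rightarrow> bool" where
  "is_table T \<longleftrightarrow> 0 < length T \<and> (\<forall>row \<in> set T. length row = length T) \<and>
     (\<forall>i < length T. \<forall>j < length T. table_mult T i j < length T) \<and>
     (\<forall>i < length T. \<forall>j < length T. \<forall>k < length T. table_mult T (table_mult T i j) k = table_mult T i (table_mult T j k)) \<and>
     (\<forall>i < length T. table_mult T 0 i = i) \<and>
     (\<forall>i < length T. \<exists>j < length T. table_mult T j i = 0)"

text \<open>Finite evidence that \<open>w\<close> represents an element that no chain of moves links to the set \<open>K\<close> with
  description \<open>c\<close>.  It consists of the table \<open>T\<close> of a finite group, the images \<open>as\<close> of the letters
  under a homomorphism (the relators must become trivial), the values \<open>fs\<close> of an endomorphism that is
  compatible with \<open>\<phi>\<close>, the output \<open>v\<close> of the procedure \<open>p\<close>, which is the code of the image of \<open>K\<close>,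
  and a set \<open>B\<close> that contains the image of \<open>w\<close>, misses the image of \<open>K\<close> and is invariant under
  the moves in the finite group.  Invariance under
  conjugation is expressed by \<open>\<psi> z \<cdot> y' = y \<cdot> z\<close> in place of \<open>y' = (\<psi> z)\<^sup>-\<^sup>1 \<cdot> y \<cdot> z\<close>, where
  \<open>\<psi>\<close> is the endomorphism or the identity; this avoids inverses.\<close>

definition refutation where
  "refutation N Rl p a b t c ws w T as fs B v \<longleftrightarrow>
     is_table T \<and>
     (\<forall>l < N + N. nth_default 0 as l < length T \<and> table_mult T (nth_default 0 as l) (nth_default 0 as (flip l)) = 0) \<and>
     (\<forall>r \<in> set Rl. table_eval T as r = 0) \<and>
     (\<forall>i < length T. nth_default 0 fs i < length T) \<and>
     (\<forall>i < length T. \<forall>j < length T.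
        nth_default 0 fs (table_mult T i j) = table_mult T (nth_default 0 fs i) (nth_default 0 fs j)) \<and>
     (\<forall>i < N. nth_default 0 fs (nth_default 0 as (i + i)) = table_eval T as (nth_default [] ws i)) \<and>
     run p [c, enc T, enc (map (\<lambda>i. nth_default 0 as (i + i)) [0..<N])] = Some v \<and>
     table_eval T as w \<in> set B \<and> (\<forall>y \<in> set B. \<not> y \<in> set_decode v) \<and>
     (a \<longrightarrow> (\<forall>y < length T. y \<in> set B \<longleftrightarrow> nth_default 0 fs y \<in> set B)) \<and>
     (b \<longrightarrow> (\<forall>y < length T. \<forall>y' < length T. \<forall>z < length T.
        table_mult T (if t then nth_default 0 fs z else z) y' = table_mult T y z \<longrightarrow> (y \<in> set B \<longleftrightarrow> y' \<in> set B)))"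

lemma table_eval_simps [simp]:
  "table_eval T as [] = 0" "table_eval T as (l # w) = table_mult T (nth_default 0 as l) (table_eval T as w)"
  by (simp_all add: table_eval_def)

lemma nth_default_map_upt [simp]: "nth_default d (map f [0..<m]) i = (if i < m then f i else d)"
  by (simp add: nth_default_def)

lemma is_table_mult:
  assumes "is_table T" "i < length T" "j < length T"
  shows "i \<otimes>\<^bsub>table_group T\<^esub> j = table_mult T i j"
  using assms by (simp add: table_group_def table_mult_def nth_default_def is_table_def)

lemma is_table_group:
  assumes "is_table T" shows "group (table_group T)"
proof (rule groupI)
  fix x y z assume "x \<in> carrier (table_group T)" "y \<in> carrier (table_group T)" "z \<in> carrier (table_group T)"
  then have xyz: "x < length T" "y < length T" "z < length T" by (simp_all add: table_group_def)
  moreover have "table_mult T x y < length T" "table_mult T y z < length T"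
    using assms xyz by (simp_all add: is_table_def)
  ultimately show "x \<otimes>\<^bsub>table_group T\<^esub> y \<otimes>\<^bsub>table_group T\<^esub> z = x \<otimes>\<^bsub>table_group T\<^esub> (y \<otimes>\<^bsub>table_group T\<^esub> z)"
    using assms by (simp add: is_table_mult) (simp add: is_table_def)
next
  fix x y assume "x \<in> carrier (table_group T)" "y \<in> carrier (table_group T)"
  then show "x \<otimes>\<^bsub>table_group T\<^esub> y \<in> carrier (table_group T)"
    using assms is_table_mult[OF assms, of x y] by (simp add: table_group_def is_table_def)
next
  fix x assume "x \<in> carrier (table_group T)"
  then have x: "x < length T" by (simp add: table_group_def)
  have "0 < length T" using assms by (simp add: is_table_def)
  with x assms show "\<one>\<^bsub>table_group T\<^esub> \<otimes>\<^bsub>table_group T\<^esub> x = x"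
    using is_table_mult[OF assms, of 0 x] by (simp add: is_table_def) (simp add: table_group_def)
  from x assms obtain j where "j < length T" "table_mult T j x = 0" by (auto simp: is_table_def)
  with x show "\<exists>y \<in> carrier (table_group T). y \<otimes>\<^bsub>table_group T\<^esub> x = \<one>\<^bsub>table_group T\<^esub>"
    using is_table_mult[OF assms, of j x] by (intro bexI[of _ j]) (simp_all add: table_group_def)
qed (use assms in \<open>simp add: table_group_def is_table_def\<close>)

lemma (in presented_group) hom_determined_by_even_generators:
  assumes "group F" "\<rho> \<in> hom G F" "\<rho>' \<in> hom G F" "\<And>i. i < N \<Longrightarrow> \<rho> (gen (i + i)) = \<rho>' (gen (i + i))"
    and "x \<in> carrier G"
  shows "\<rho> x = \<rho>' x"
proof (rule hom_determined_by_generators[OF assms(1-3) _ assms(5)])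
  interpret r: group_hom G F \<rho> using assms by (simp add: group_hom_def group_hom_axioms_def is_group)
  interpret r': group_hom G F \<rho>' using assms by (simp add: group_hom_def group_hom_axioms_def is_group)
  fix l assume l: "l < N + N"
  show "\<rho> (gen l) = \<rho>' (gen l)"
  proof (cases "even l")
    case True
    then have "l = l div 2 + l div 2" "l div 2 < N" using l by presburger+
    then show ?thesis using assms(4) by metis
  next
    case False
    then have "flip l = l div 2 + l div 2" "l div 2 < N" using l by (simp add: flip_def; presburger)+
    moreover have "gen l = inv (gen (flip l))"
      using gen_flip_inv[OF flip_less[OF l]] by simp
    ultimately show ?thesis using assms(4) l by (simp add: gen_closed flip_less)
  qed
qed

context presented_group
begin

text \<open>The homomorphism is handed over by its values at the even letters, which are the generators
  themselves.\<close>

definition computes_images :: "recf \<Rightarrow> nat \<Rightarrow> 'a set \<Rightarrow> bool" where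
  "computes_images p c K \<longleftrightarrow> (\<forall>T \<theta>. group_table T \<longrightarrow> \<theta> \<in> hom G (table_group T) \<longrightarrow>
     run p [c, enc T, enc (map (\<lambda>i. \<theta> (gen (i + i))) [0..<N])] = Some (set_encode (\<theta> ` K)))"

end

text \<open>By the kernel condition of the presentation the images of the letters extend to a homomorphism
  \<open>\<theta>\<close>, and the preimage of \<open>B\<close> under \<open>\<theta>\<close> is invariant under moves, contains the given element
  and misses \<open>K\<close>.\<close>

theorem (in presented_endo) refutation_sound:
  assumes ref: "refutation N Rl p a b t c ws w T as fs B v"
    and Rl: "set Rl = R" and p: "computes_images p c K" and K: "K \<subseteq> carrier G" and w: "w \<in> nat_words N"
  shows "\<not> (\<exists>s \<in> K. equivclp (move G a b t \<phi>) (val w) s)"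
proof
  let ?m = "length T" and ?F = "table_group T" and ?g = "nth_default 0 as" and ?f = "nth_default 0 fs"
  have T: "is_table T"
    and as: "\<forall>l < N + N. ?g l < ?m \<and> table_mult T (?g l) (?g (flip l)) = 0"
    and relators_0: "\<forall>r \<in> set Rl. table_eval T as r = 0"
    and f_less: "\<forall>i < ?m. ?f i < ?m"
    and f_mult: "\<forall>i < ?m. \<forall>j < ?m. ?f (table_mult T i j) = table_mult T (?f i) (?f j)"
    and f_gen: "\<forall>i < N. ?f (?g (i + i)) = table_eval T as (nth_default [] ws i)"
    and run: "run p [c, enc T, enc (map (\<lambda>i. ?g (i + i)) [0..<N])] = Some v"
    and w_B: "table_eval T as w \<in> set B"
    and B_v: "\<forall>y \<in> set B. \<not> y \<in> set_decode v"
    and B_endo: "a \<longrightarrow> (\<forall>y < ?m. y \<in> set B \<longleftrightarrow> ?f y \<in> set B)"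
    and B_conj: "b \<longrightarrow> (\<forall>y < ?m. \<forall>y' < ?m. \<forall>z < ?m.
      table_mult T (if t then ?f z else z) y' = table_mult T y z \<longrightarrow> (y \<in> set B \<longleftrightarrow> y' \<in> set B))"
    using ref unfolding refutation_def by - (elim conjE, assumption)+
  from as have as_less: "?g l < ?m" and as_flip: "table_mult T (?g l) (?g (flip l)) = 0" if "l < N + N" for l
    using that by blast+
  interpret F: group ?F by (rule is_table_group[OF T])
  have carrier: "carrier ?F = {..<?m}" and one: "\<one>\<^bsub>?F\<^esub> = 0" by (simp_all add: table_group_def)
  have mult: "x \<otimes>\<^bsub>?F\<^esub> y = table_mult T x y" if "x < ?m" "y < ?m" for x y
    using is_table_mult[OF T that] .
  interpret F: word_group ?F N ?g
    by unfold_locales (auto simp: carrier one mult flip_less as_less as_flip)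
  have table_eval: "eval_word ?F ?g u = table_eval T as u" if "u \<in> nat_words N" for u
    using that
  proof (induction u)
    case (Cons l u)
    then show ?case using F.gen_closed[of l] F.eval_word_closed[of u] by (simp add: carrier mult)
  qed (simp add: one)
  have FR: "r \<in> nat_words N \<and> eval_word ?F ?g r = \<one>\<^bsub>?F\<^esub>" if "r \<in> R" for r
    using that relators_0 Rl relators table_eval by (auto simp: one)
  define \<theta> where "\<theta> x = table_eval T as (SOME u. u \<in> nat_words N \<and> val u = x)" for x
  have \<theta>: "\<theta> (val u) = eval_word ?F ?g u" if "u \<in> nat_words N" for u
  proof -
    let ?u = "SOME u'. u' \<in> nat_words N \<and> val u' = val u"
    have u': "?u \<in> nat_words N \<and> val ?u = val u" by (rule someI[of _ u]) (use that in simp)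
    then have "equivclp (nat_insertion N R) ?u u" using val_eq_iff that by blast
    then have "eval_word ?F ?g ?u = eval_word ?F ?g u" using F.eval_word_equivclp_nat_insertion[of R, OF FR] u' by blast
    then show ?thesis using u' by (simp add: \<theta>_def table_eval)
  qed
  have hom: "\<theta> \<in> hom G ?F"
  proof (rule homI)
    fix x y assume "x \<in> carrier G" "y \<in> carrier G"
    then obtain u u' where u: "u \<in> nat_words N" "u' \<in> nat_words N" "val u = x" "val u' = y"
      using val_cases by metis
    then have "x \<otimes> y = val (u @ u')" by (simp add: eval_word_append)
    then show "\<theta> (x \<otimes> y) = \<theta> x \<otimes>\<^bsub>?F\<^esub> \<theta> y"
      using u \<theta>[of u] \<theta>[of u'] \<theta>[of "u @ u'"] by (simp add: F.eval_word_append)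
  next
    fix x assume "x \<in> carrier G"
    then show "\<theta> x \<in> carrier ?F" using val_cases[of x] \<theta> F.eval_word_closed by metis
  qed
  interpret \<theta>: group_hom G ?F \<theta> using hom by unfold_locales
  have \<theta>_less: "\<theta> x < ?m" if "x \<in> carrier G" for x
    using \<theta>.hom_closed[OF that] by (simp add: carrier)
  have \<theta>_gen: "\<theta> (gen l) = ?g l" if "l < N + N" for l
    using \<theta>[of "[l]"] that by (simp add: gen_closed F.gen_closed)
  have "map (\<lambda>i. \<theta> (gen (i + i))) [0..<N] = map (\<lambda>i. ?g (i + i)) [0..<N]"
    using \<theta>_gen by simp
  moreover have "group_table T"
    using T F.is_group by (simp add: group_table_def is_table_def)
  ultimately have "run p [c, enc T, enc (map (\<lambda>i. ?g (i + i)) [0..<N])] = Some (set_encode (\<theta> ` K))"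
    using p hom unfolding computes_images_def by metis
  then have v: "v = set_encode (\<theta> ` K)" using run by simp
  have "\<theta> ` K \<subseteq> {..<?m}" using \<theta>_less K by auto
  then have "set_decode v = \<theta> ` K" unfolding v by (meson finite_lessThan finite_subset set_encode_inverse)
  then have disjoint: "\<theta> s \<notin> set B" if "s \<in> K" for s using B_v that by blast
  have f_hom: "?f \<in> hom ?F ?F"
    by (rule homI) (use f_less f_mult in \<open>simp_all add: carrier mult\<close>)
  have commute: "?f (\<theta> x) = \<theta> (\<phi> x)" if x: "x \<in> carrier G" for x
  proof -
    have 1: "compose (carrier G) ?f \<theta> \<in> hom G ?F" using hom_compose[OF hom f_hom] .
    have 2: "compose (carrier G) \<theta> \<phi> \<in> hom G ?F" using hom_compose[OF endo hom] .
    have "compose (carrier G) ?f \<theta> x = compose (carrier G) \<theta> \<phi> x"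
    proof (rule hom_determined_by_even_generators[OF F.is_group 1 2 _ x])
      fix i assume i: "i < N"
      let ?u = "nth_default [] ws i"
      have "?f (\<theta> (gen (i + i))) = table_eval T as ?u" using f_gen i \<theta>_gen[of "i + i"] by auto
      also have "\<dots> = \<theta> (val ?u)" using images[OF i] \<theta>[of ?u] table_eval[of ?u] by simp
      also have "\<dots> = \<theta> (\<phi> (gen (i + i)))" using images[OF i] by (simp add: mult_2)
      finally show "compose (carrier G) ?f \<theta> (gen (i + i)) = compose (carrier G) \<theta> \<phi> (gen (i + i))"
        using i by (simp add: compose_eq gen_closed)
    qed
    then show ?thesis using x by (simp add: compose_eq)
  qed
  have inv: "\<theta> x \<in> set B \<longleftrightarrow> \<theta> y \<in> set B" if xy: "move G a b t \<phi> x y" for x y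
  proof -
    from xy have x: "x \<in> carrier G" by (simp add: move_def)
    from xy consider "a" "y = \<phi> x"
      | z where "b" "z \<in> carrier G" "y = inv (if t then \<phi> z else z) \<otimes> x \<otimes> z"
      by (auto simp: move_def)
    then show ?thesis
    proof cases
      case 1
      then show ?thesis using B_endo 1 \<theta>_less[OF x] commute[OF x] by simp
    next
      case 2
      let ?\<psi> = "if t then \<phi> z else z"
      have psi: "?\<psi> \<in> carrier G" using 2 by simp
      have y: "y \<in> carrier G" using 2 x psi by simp
      have "?\<psi> \<otimes> y = x \<otimes> z" unfolding 2(3) using psi x 2(2) by (simp add: m_assoc[symmetric])
      then have "\<theta> ?\<psi> \<otimes>\<^bsub>?F\<^esub> \<theta> y = \<theta> x \<otimes>\<^bsub>?F\<^esub> \<theta> z"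
        using psi x y 2(2) by (metis \<theta>.hom_mult)
      then have "table_mult T (\<theta> ?\<psi>) (\<theta> y) = table_mult T (\<theta> x) (\<theta> z)"
        using psi x y 2(2) \<theta>_less mult by simp
      moreover have "\<theta> ?\<psi> = (if t then ?f (\<theta> z) else \<theta> z)" using commute[OF 2(2)] by simp
      ultimately show ?thesis using B_conj[rule_format, OF 2(1) \<theta>_less[OF x] \<theta>_less[OF y] \<theta>_less[OF 2(2)]] by simp
    qed
  qed
  assume "\<exists>s \<in> K. equivclp (move G a b t \<phi>) (val w) s"
  then obtain s where s: "s \<in> K" "equivclp (move G a b t \<phi>) (val w) s" by blast
  have "\<theta> (val w) \<in> set B" using w_B \<theta>[OF w] table_eval[OF w] by simp
  with s(2) have "\<theta> s \<in> set B"
    by (induction rule: equivclp_induct) (use inv in blast)+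
  then show False using disjoint s(1) by blast
qed

text \<open>The quotient that separates the element from the saturation \<open>S\<close> of \<open>K\<close> serves, with the complement of
  the image of \<open>S\<close> for \<open>B\<close>.  The image of \<open>S\<close> is invariant in both directions, since \<open>S\<close> is a
  union of classes; to go backwards along \<open>\<phi>\<close> the induced map of the finite quotient must be
  injective, which follows from its surjectivity.\<close>

theorem (in presented_endo) refutation_complete:
  assumes surj: "\<phi> ` carrier G = carrier G"
    and sep: "separable G (saturation (move G a b t \<phi>) K)"
    and Rl: "set Rl = R" and p: "computes_images p c K" and K: "K \<subseteq> carrier G" and w: "w \<in> nat_words N"
    and no: "\<not> (\<exists>s \<in> K. equivclp (move G a b t \<phi>) (val w) s)"
  shows "\<exists>T as fs B v. refutation N Rl p a b t c ws w T as fs B v"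
proof -
  define S where "S = saturation (move G a b t \<phi>) K"
  have S_carrier: "S \<subseteq> carrier G" and K_S: "K \<subseteq> S"
    using K equivclp_refl[of "move G a b t \<phi>"] unfolding S_def saturation_def by blast+
  have S_move: "x \<in> S \<longleftrightarrow> y \<in> S" if "move G a b t \<phi> x y" for x y
  proof -
    have "equivclp (move G a b t \<phi>) x y" using that by (rule equivclp_base)
    then have "equivclp (move G a b t \<phi>) x s \<longleftrightarrow> equivclp (move G a b t \<phi>) y s" for s
      by (meson equivclp_sym equivclp_trans)
    moreover have "x \<in> carrier G" "y \<in> carrier G"
      using that move_closed[OF that] by (simp_all add: move_def)
    ultimately show ?thesis by (simp add: S_def saturation_def)
  qed
  have "val w \<notin> S" using no by (simp add: S_def saturation_def)
  then obtain m :: nat and \<theta> where \<theta>_image: "\<theta> ` carrier G = {..<m}" and \<theta>_one: "\<theta> \<one> = 0"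
    and c1: "\<forall>g \<in> carrier G. \<forall>g' \<in> carrier G. \<forall>h \<in> carrier G. \<forall>h' \<in> carrier G.
       \<theta> g = \<theta> g' \<longrightarrow> \<theta> h = \<theta> h' \<longrightarrow> \<theta> (g \<otimes> h) = \<theta> (g' \<otimes> h')"
    and c2: "\<forall>g \<in> carrier G. \<forall>g' \<in> carrier G. \<theta> g = \<theta> g' \<longrightarrow> \<theta> (\<phi> g) = \<theta> (\<phi> g')"
    and sep: "\<forall>s \<in> S \<inter> carrier G. \<theta> s \<noteq> \<theta> (val w)"
    by (rule separating_finite_quotient[OF sep[folded S_def] eval_word_closed[OF w] _ endo]) (rule that)
  have cong: "\<theta> (g \<otimes> h) = \<theta> (g' \<otimes> h')"
    if "g \<in> carrier G" "h \<in> carrier G" "g' \<in> carrier G" "h' \<in> carrier G" "\<theta> g = \<theta> g'" "\<theta> h = \<theta> h'"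
    for g h g' h'
    using c1 that by blast
  have cong_endo: "\<theta> (\<phi> g) = \<theta> (\<phi> g')" if "g \<in> carrier G" "g' \<in> carrier G" "\<theta> g = \<theta> g'" for g g'
    using c2 that by blast
  define rep where "rep = inv_into (carrier G) \<theta>"
  have rep: "rep i \<in> carrier G" "\<theta> (rep i) = i" if "i < m" for i
    using that \<theta>_image by (auto simp: rep_def inv_into_into f_inv_into_f)
  have less: "\<theta> x < m" if "x \<in> carrier G" for x using \<theta>_image that by auto
  define T where "T = map (\<lambda>i. map (\<lambda>j. \<theta> (rep i \<otimes> rep j)) [0..<m]) [0..<m]"
  define as where "as = map (\<lambda>l. \<theta> (gen l)) [0..<N + N]"
  define fs where "fs = map (\<lambda>i. \<theta> (\<phi> (rep i))) [0..<m]"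
  define B where "B = filter (\<lambda>y. y \<notin> \<theta> ` S) [0..<m]"
  have len: "length T = m" by (simp add: T_def)
  have table_mult: "table_mult T (\<theta> x) (\<theta> y) = \<theta> (x \<otimes> y)" if "x \<in> carrier G" "y \<in> carrier G" for x y
  proof -
    have "table_mult T (\<theta> x) (\<theta> y) = \<theta> (rep (\<theta> x) \<otimes> rep (\<theta> y))"
      using less that by (simp add: table_mult_def T_def)
    also have "\<dots> = \<theta> (x \<otimes> y)" by (rule cong) (use that less rep in simp_all)
    finally show ?thesis .
  qed
  have ex: "\<exists>x \<in> carrier G. i = \<theta> x" if "i < m" for i using rep that by metis
  have fs: "nth_default 0 fs (\<theta> x) = \<theta> (\<phi> x)" if "x \<in> carrier G" for x
  proof -
    have "nth_default 0 fs (\<theta> x) = \<theta> (\<phi> (rep (\<theta> x)))" using less[OF that] by (simp add: fs_def)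
    also have "\<dots> = \<theta> (\<phi> x)" by (rule cong_endo) (use that less rep in simp_all)
    finally show ?thesis .
  qed
  have as: "nth_default 0 as l = \<theta> (gen l)" if "l < N + N" for l
    using that by (simp add: as_def)
  have table_eval: "table_eval T as u = \<theta> (val u)" if "u \<in> nat_words N" for u
    using that by (induction u) (simp_all add: \<theta>_one as table_mult gen_closed)
  have table: "is_table T"
    unfolding is_table_def len
  proof (intro conjI allI impI)
    show "0 < m" using less[of \<one>] by simp
    show "\<forall>row \<in> set T. length row = m" by (auto simp: T_def)
    fix i assume "i < m"
    then obtain x where x: "x \<in> carrier G" "i = \<theta> x" using ex by blast
    then show "table_mult T 0 i = i" using table_mult[of \<one> x] \<theta>_one by simp
    show "\<exists>j < m. table_mult T j i = 0"
      using x less[of "inv x"] table_mult[of "inv x" x] \<theta>_one by (intro exI[of _ "\<theta> (inv x)"]) simp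
    fix j assume "j < m"
    then obtain y where y: "y \<in> carrier G" "j = \<theta> y" using ex by blast
    then show "table_mult T i j < m" using x less table_mult by simp
    fix k assume "k < m"
    then obtain z where z: "z \<in> carrier G" "k = \<theta> z" using ex by blast
    then show "table_mult T (table_mult T i j) k = table_mult T i (table_mult T j k)" using x y table_mult by (simp add: m_assoc)
  qed
  have "group_table T"
    using table is_table_group[OF table] by (simp add: group_table_def is_table_def)
  moreover have "\<theta> \<in> hom G (table_group T)"
    by (rule homI) (use less table_mult is_table_mult[OF table] len in \<open>auto simp: table_group_def\<close>)
  ultimately have run: "run p [c, enc T, enc (map (\<lambda>i. \<theta> (gen (i + i))) [0..<N])] = Some (set_encode (\<theta> ` K))"
    using p by (simp add: computes_images_def)
  have "finite (\<theta> ` K)"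
    by (rule finite_subset[of _ "{..<m}"]) (use less K in auto)
  then have decode: "set_decode (set_encode (\<theta> ` K)) = \<theta> ` K" by simp
  \<comment> \<open>As \<open>\<phi>\<close> is onto, so is the induced map; a surjection of a finite set to itself is injective.\<close>
  have "inj_on (nth_default 0 fs) {..<m}"
  proof (rule finite_surj_inj)
    have "{..<m} = (\<lambda>x. \<theta> (\<phi> x)) ` carrier G" using surj \<theta>_image by (metis image_image)
    also have "\<dots> = nth_default 0 fs ` {..<m}"
      unfolding \<theta>_image[symmetric] image_image using fs by simp
    finally show "{..<m} \<subseteq> nth_default 0 fs ` {..<m}" by simp
  qed simp
  then have fs_inj: "\<theta> x = \<theta> y" if "\<theta> (\<phi> x) = \<theta> (\<phi> y)" "x \<in> carrier G" "y \<in> carrier G" for x y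
    using that fs less by (metis inj_onD lessThan_iff)
  have in_B: "\<theta> x \<in> set B \<longleftrightarrow> \<theta> x \<notin> \<theta> ` S" if "x \<in> carrier G" for x
    using less[OF that] by (simp add: B_def)
  have B_endo: "\<theta> x \<in> \<theta> ` S \<longleftrightarrow> \<theta> (\<phi> x) \<in> \<theta> ` S" if "a" "x \<in> carrier G" for x
  proof
    assume "\<theta> x \<in> \<theta> ` S"
    then obtain s where s: "s \<in> S" "\<theta> x = \<theta> s" by blast
    then have "\<phi> s \<in> S" using S_move[of s "\<phi> s"] S_carrier that by (auto simp: move_def)
    then show "\<theta> (\<phi> x) \<in> \<theta> ` S" using cong_endo[of x s] s S_carrier that by blast
  next
    assume "\<theta> (\<phi> x) \<in> \<theta> ` S"
    then obtain s where s: "s \<in> S" "\<theta> (\<phi> x) = \<theta> s" by blast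
    then obtain s' where s': "s' \<in> carrier G" "s = \<phi> s'" using surj S_carrier by blast
    then have "s' \<in> S" using S_move[of s' s] s that by (simp add: move_def)
    then show "\<theta> x \<in> \<theta> ` S" using fs_inj[of x s'] s s' that by blast
  qed
  have B_conj: "\<theta> x \<in> \<theta> ` S \<longleftrightarrow> \<theta> y \<in> \<theta> ` S"
    if "b" "x \<in> carrier G" "y \<in> carrier G" "z \<in> carrier G"
      "\<theta> ((if t then \<phi> z else z) \<otimes> y) = \<theta> (x \<otimes> z)" for x y z
  proof -
    define \<psi> where "\<psi> = (if t then \<phi> z else z)"
    have psi: "\<psi> \<in> carrier G" using that by (simp add: \<psi>_def)
    have eq: "\<theta> (\<psi> \<otimes> y) = \<theta> (x \<otimes> z)" using that by (simp add: \<psi>_def)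
    have step: "move G a b t \<phi> s (inv \<psi> \<otimes> s \<otimes> z)" if "s \<in> carrier G" for s
      using that \<open>b\<close> \<open>z \<in> carrier G\<close> by (auto simp: move_def \<psi>_def)
    show ?thesis
    proof
      assume "\<theta> x \<in> \<theta> ` S"
      then obtain s where s: "s \<in> S" "\<theta> x = \<theta> s" by blast
      then have sc: "s \<in> carrier G" using S_carrier by blast
      have "\<theta> y = \<theta> (inv \<psi> \<otimes> (\<psi> \<otimes> y))" using psi that by (simp add: m_assoc[symmetric])
      also have "\<dots> = \<theta> (inv \<psi> \<otimes> (x \<otimes> z))" by (rule cong) (use psi that eq in simp_all)
      also have "\<dots> = \<theta> (inv \<psi> \<otimes> x \<otimes> z)" using psi that by (simp add: m_assoc)
      also have "\<dots> = \<theta> (inv \<psi> \<otimes> s \<otimes> z)" by (intro cong) (use psi that s sc in simp_all)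
      finally show "\<theta> y \<in> \<theta> ` S" using S_move[OF step[OF sc]] s by blast
    next
      assume "\<theta> y \<in> \<theta> ` S"
      then obtain s where s: "s \<in> S" "\<theta> y = \<theta> s" by blast
      then have sc: "s \<in> carrier G" using S_carrier by blast
      let ?u = "\<psi> \<otimes> s \<otimes> inv z"
      have uc: "?u \<in> carrier G" using psi sc that by simp
      have "inv \<psi> \<otimes> ?u \<otimes> z = s" using psi sc that by (simp add: m_assoc) (simp add: m_assoc[symmetric])
      then have u: "?u \<in> S" using S_move[OF step[OF uc]] s by simp
      have "\<theta> x = \<theta> ((x \<otimes> z) \<otimes> inv z)" using that by (simp add: m_assoc)
      also have "\<dots> = \<theta> ((\<psi> \<otimes> y) \<otimes> inv z)" by (rule cong) (use psi that eq in simp_all)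
      also have "\<dots> = \<theta> ?u" by (intro cong) (use psi that s sc in simp_all)
      finally show "\<theta> x \<in> \<theta> ` S" using u by blast
    qed
  qed
  have "refutation N Rl p a b t c ws w T as fs B (set_encode (\<theta> ` K))"
    unfolding refutation_def len
  proof (intro conjI allI impI)
    show "is_table T" by (rule table)
    fix l assume "l < N + N"
    then show "nth_default 0 as l < m" "table_mult T (nth_default 0 as l) (nth_default 0 as (flip l)) = 0"
      by (simp_all add: as less gen_closed flip_less table_mult gen_flip \<theta>_one)
  next
    show "\<forall>r \<in> set Rl. table_eval T as r = 0"
      using Rl relator_val table_eval \<theta>_one by auto
    show "nth_default 0 fs i < m" if "i < m" for i
      using ex[OF that] fs less endo_closed by metis
    show "nth_default 0 fs (table_mult T i j) = table_mult T (nth_default 0 fs i) (nth_default 0 fs j)"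
      if ij: "i < m" "j < m" for i j
      using ex[OF ij(1)] ex[OF ij(2)] by (auto simp: table_mult fs endo_mult)
    show "nth_default 0 fs (nth_default 0 as (i + i)) = table_eval T as (nth_default [] ws i)" if "i < N" for i
      using that images[OF that] by (simp add: as fs gen_closed table_eval mult_2)
    have "map (\<lambda>i. nth_default 0 as (i + i)) [0..<N] = map (\<lambda>i. \<theta> (gen (i + i))) [0..<N]"
      by (simp add: as)
    with run show "run p [c, enc T, enc (map (\<lambda>i. nth_default 0 as (i + i)) [0..<N])] = Some (set_encode (\<theta> ` K))"
      by (simp only:)
    show "table_eval T as w \<in> set B"
      using table_eval[OF w] in_B[OF eval_word_closed[OF w]] sep S_carrier by force
    show "\<forall>y \<in> set B. \<not> y \<in> set_decode (set_encode (\<theta> ` K))"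
      unfolding decode using K_S by (auto simp: B_def)
    show "y \<in> set B \<longleftrightarrow> nth_default 0 fs y \<in> set B" if "a" "y < m" for y
      using ex[OF that(2)] B_endo[OF that(1)] in_B fs endo_closed by metis
    show "y \<in> set B \<longleftrightarrow> y' \<in> set B"
      if "b" and less: "y < m" "y' < m" "z < m" and eq: "table_mult T (if t then nth_default 0 fs z else z) y' = table_mult T y z"
      for y y' z
    proof -
      obtain g g' h where g: "g \<in> carrier G" "g' \<in> carrier G" "h \<in> carrier G" "y = \<theta> g" "y' = \<theta> g'" "z = \<theta> h"
        using ex less by metis
      have "\<theta> ((if t then \<phi> h else h) \<otimes> g') = \<theta> (g \<otimes> h)"
        using eq g table_mult[of "\<phi> h" g'] table_mult[of h g'] table_mult[of g h] fs[of h] by (cases t) simp_all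
      then show ?thesis using B_conj[OF \<open>b\<close> g(1,2,3)] in_B g by simp
    qed
  qed
  then show ?thesis by blast
qed

section \<open>Effectiveness of the two searches\<close>

lemma computable_flip [computable_intros]: "computable f \<Longrightarrow> computable (\<lambda>x. flip (f x))"
  unfolding flip_def by (intro computable_intros decidable_intros)

lemma computable_inverse_word [computable_intros]: "computable f \<Longrightarrow> computable (\<lambda>x. inverse_word (f x))"
  unfolding inverse_word_def by (intro computable_intros)

lemma computable_substitute [computable_intros]:
  assumes "computable ws" "computable w" shows "computable (\<lambda>x. substitute (ws x) (w x))"
  unfolding substitute_def by (intro computable_intros decidable_intros assms computable_compose[OF assms(1)])

lemma decidable_nat_words [decidable_intros]:
  assumes "computable w" shows "decidable (\<lambda>x. w x \<in> nat_words N)"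
proof -
  have eq: "w x \<in> nat_words N \<longleftrightarrow> (\<forall>l \<in> set (w x). l < N + N)" for x by (simp add: nat_words_def)
  show ?thesis unfolding eq by (intro decidable_intros computable_intros assms)
qed

lemma semidecidable_equivclp_word_move:
  assumes "computable ws" "computable u" "computable v"
  shows "semidecidable (\<lambda>x. equivclp (word_move N (set Rl) a b t (ws x)) (u x) (v x))"
proof -
  have sd: "semidecidable (\<lambda>x. word_move N (set Rl) a b t (ws' x) (u' x) (v' x))"
    if "computable ws'" "computable u'" "computable v'"
    for ws' :: "'b::coded \<Rightarrow> nat list list" and u' v'
  proof -
    note comp = that[THEN computable_compose]
    show ?thesis
      unfolding word_move_def nat_insertion_def
      by (intro semidecidable_intros; intro semidecidable_decidable decidable_intros computable_intros that comp)
  qed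
  have "semidecidable (\<lambda>x. symclp (word_move N (set Rl) a b t (ws (snd (snd x)))) (fst x) (fst (snd x)))"
    unfolding symclp_def
    by (intro semidecidable_disj sd computable_intros computable_compose[OF assms(1)])
  then show ?thesis
    unfolding equivclp_def
    by (rule semidecidable_rtranclp[where r = "\<lambda>x. symclp (word_move N (set Rl) a b t (ws x))"])
      (intro assms)+
qed

lemma decidable_is_table [decidable_intros]:
  assumes "computable f" shows "decidable (\<lambda>x. is_table (f x))"
  unfolding is_table_def table_mult_def
  by (intro decidable_intros computable_intros assms computable_compose[OF assms])

lemma semidecidable_refutable:
  "semidecidable (\<lambda>x. \<exists>T as fs B v. refutation N Rl p a b t (fst x) (fst (snd x)) (snd (snd x)) T as fs B v)"
  unfolding refutation_def table_mult_def table_eval_def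
  by (intro semidecidable_intros; intro semidecidable_decidable decidable_intros computable_intros)

section \<open>From finite presentations to coded words\<close>

definition code_word :: "word \<Rightarrow> nat list" where
  "code_word w = map (\<lambda>(i, e). 2 * i + (if e then 1 else 0)) w"

definition word_of :: "nat list \<Rightarrow> word" where
  "word_of w = map (\<lambda>l. (l div 2, odd l)) w"

definition letter :: "('a, 'b) monoid_scheme \<Rightarrow> 'a list \<Rightarrow> nat \<Rightarrow> 'a" where
  "letter G gs l = (if odd l then inv\<^bsub>G\<^esub> (gs ! (l div 2)) else gs ! (l div 2))"

lemma word_of_code_word [simp]: "word_of (code_word w) = w"
  by (induction w) (auto simp: word_of_def code_word_def split: if_splits)

lemma code_word_word_of [simp]: "code_word (word_of w) = w"
  by (induction w) (auto simp: word_of_def code_word_def)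

lemma code_word_append [simp]: "code_word (u @ v) = code_word u @ code_word v"
  by (simp add: code_word_def)

lemma word_of_append [simp]: "word_of (u @ v) = word_of u @ word_of v"
  by (simp add: word_of_def)

lemma enc_nat_list: "(enc :: nat list \<Rightarrow> nat) = list_encode"
  by (rule ext) (simp add: enc_list_def map_idI)

lemma word_code_eq: "word_code w = enc (code_word w)"
  by (simp add: word_code_def code_word_def enc_nat_list)

lemma tuple_code_eq: "tuple_code ws = enc (map code_word ws)"
  unfolding tuple_code_def enc_list_def[where 'a = "nat list"] by (simp add: comp_def word_code_eq[abs_def])

lemma table_code_eq: "table_code T = enc T"
  unfolding table_code_def enc_list_def[where 'a = "nat list"] by (simp add: enc_nat_list)

lemma code_word_nat_words [simp]: "code_word w \<in> nat_words n \<longleftrightarrow> w \<in> words n"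
  by (induction w) (auto simp: code_word_def words_def nat_words_def)

lemma word_val_eq: "word_val G gs w = eval_word G (letter G gs) (code_word w)"
  by (induction w) (auto simp: code_word_def letter_def)

lemma nat_insertion_code_word:
  "insertion n R u v \<Longrightarrow> nat_insertion n (code_word ` R) (code_word u) (code_word v)"
proof (induction rule: insertion.induct)
  case (1 i u v e)
  let ?l = "2 * i + (if e then 1 else 0)"
  have "?l < n + n" "code_word [(i, e), (i, \<not> e)] = [?l, flip ?l]"
    using 1 by (auto simp: code_word_def flip_def)
  then show ?case unfolding nat_insertion_def code_word_append by blast
next
  case (2 r u v)
  then show ?case unfolding nat_insertion_def code_word_append by blast
qed

lemma insertion_word_of:
  assumes "nat_insertion n (code_word ` R) u v" shows "insertion n R (word_of u) (word_of v)"
proof -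
  from assms obtain a b where u: "u = a @ b"
    and "(\<exists>l < n + n. v = a @ [l, flip l] @ b) \<or> (\<exists>r \<in> code_word ` R. v = a @ r @ b)"
    unfolding nat_insertion_def by blast
  then consider l where "l < n + n" "v = a @ [l, flip l] @ b" | r where "r \<in> R" "v = a @ code_word r @ b"
    by blast
  then show ?thesis
  proof cases
    case 1
    then have "word_of [l, flip l] = [(l div 2, odd l), (l div 2, \<not> odd l)]"
      by (auto simp: word_of_def flip_def elim!: oddE)
    then have "word_of v = word_of a @ [(l div 2, odd l), (l div 2, \<not> odd l)] @ word_of b"
      unfolding 1(2) by (simp del: append.simps)
    moreover have "l div 2 < n" using 1 by linarith
    ultimately show ?thesis unfolding u word_of_append by (simp only: insertion.intros(1))
  next
    case 2
    then show ?thesis unfolding u 2(2) word_of_append word_of_code_word by (simp only: insertion.intros(2))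
  qed
qed

text \<open>The coding of letters is a bijection between \<^typ>\<open>nat \<times> bool\<close> and \<^typ>\<open>nat\<close>, so chains of
  insertions correspond in both directions.\<close>

lemma finite_presentation_presented_group:
  assumes "finite_presentation G gs R"
  shows "presented_group G (length gs) (letter G gs) (code_word ` R)"
proof -
  interpret group G using assms by (simp add: finite_presentation_def)
  let ?n = "length gs" and ?R = "code_word ` R"
  have gs: "gs ! i \<in> carrier G" if "i < ?n" for i
    using assms that by (auto simp: finite_presentation_def)
  have half: "l div 2 < ?n" if "l < ?n + ?n" for l using that by linarith
  show ?thesis
  proof unfold_locales
    fix l assume l: "l < ?n + ?n"
    then show "letter G gs l \<in> carrier G" using gs half by (simp add: letter_def)
    have "flip l div 2 = l div 2" "odd (flip l) \<longleftrightarrow> even l"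
      by (auto simp: flip_def elim!: oddE)
    then show "letter G gs l \<otimes>\<^bsub>G\<^esub> letter G gs (flip l) = \<one>\<^bsub>G\<^esub>"
      using gs half[OF l] by (simp add: letter_def)
  next
    show "?R \<subseteq> nat_words ?n"
      using assms by (auto simp: finite_presentation_def)
    have "nat_words ?n = code_word ` words ?n"
    proof (intro equalityI subsetI)
      fix w assume "w \<in> nat_words ?n"
      then show "w \<in> code_word ` words ?n"
        using code_word_nat_words[of "word_of w"] by (intro image_eqI[of _ _ "word_of w"]) simp_all
    qed auto
    then show "eval_word G (letter G gs) ` nat_words ?n = carrier G"
      using assms by (simp add: finite_presentation_def word_val_eq image_image)
    fix w assume w: "w \<in> nat_words ?n"
    then have w': "word_of w \<in> words ?n" using code_word_nat_words[of "word_of w"] by simp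
    have "eval_word G (letter G gs) w = \<one>\<^bsub>G\<^esub> \<longleftrightarrow> equivclp (insertion ?n R) [] (word_of w)"
    proof -
      have "word_val G gs (word_of w) = \<one>\<^bsub>G\<^esub> \<longleftrightarrow> equivclp (insertion ?n R) [] (word_of w)"
        using assms w' unfolding finite_presentation_def by blast
      then show ?thesis by (simp add: word_val_eq)
    qed
    also have "\<dots> \<longleftrightarrow> equivclp (nat_insertion ?n ?R) [] w"
    proof
      assume "equivclp (insertion ?n R) [] (word_of w)"
      then have "equivclp (nat_insertion ?n ?R) (code_word []) (code_word (word_of w))"
        by (rule equivclp_map) (intro equivclp_base nat_insertion_code_word)
      then show "equivclp (nat_insertion ?n ?R) [] w" by (simp add: code_word_def[of "[]"])
    next
      assume "equivclp (nat_insertion ?n ?R) [] w"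
      then have "equivclp (insertion ?n R) (word_of []) (word_of w)"
        by (rule equivclp_map) (intro equivclp_base insertion_word_of)
      then show "equivclp (insertion ?n R) [] (word_of w)" by (simp add: word_of_def[of "[]"])
    qed
    finally show "eval_word G (letter G gs) w = \<one>\<^bsub>G\<^esub> \<longleftrightarrow> equivclp (nat_insertion ?n ?R) [] w" .
  qed
qed

section \<open>Deciding membership in saturations\<close>

text \<open>A positive answer is found by listing \<open>K\<close> and searching for a chain of word moves to a listed word,
  a negative one by searching for a refutation.\<close>

theorem saturation_problem_decidable:
  assumes pres: "finite_presentation G gs R"
    and C: "C \<subseteq> Pow (carrier G)"
    and coding: "effective_coding G gs D \<nu> C"
    and images: "finite_computable_class G gs D \<nu>"
    and sep: "\<forall>K \<in> C. \<forall>\<phi> \<in> auto G. separable G (group.saturation G (move G a b t \<phi>) K)"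
    and Q: "\<And>K \<phi> x. K \<subseteq> carrier G \<Longrightarrow> \<phi> \<in> auto G \<Longrightarrow> x \<in> carrier G \<Longrightarrow>
      Q K \<phi> x \<longleftrightarrow> (\<exists>s \<in> K. equivclp (move G a b t \<phi>) x s)"
  shows "decidable_problem G gs D \<nu> Q"
proof -
  define N where "N = length gs"
  have "finite (code_word ` R)" using pres by (simp add: finite_presentation_def)
  then obtain Rl where Rl: "set Rl = code_word ` R" using finite_list by metis
  interpret presented_group G N "letter G gs" "set Rl"
    unfolding N_def Rl by (rule finite_presentation_presented_group[OF pres])
  obtain pl where listing: "\<And>c k. c \<in> D \<Longrightarrow> run pl [c, k] = Some 0 \<or>
        (\<exists>w \<in> words N. run pl [c, k] = Some (Suc (word_code w)))"
      "\<And>c. c \<in> D \<Longrightarrow> \<nu> c = {word_val G gs w | w k. w \<in> words N \<and> run pl [c, k] = Some (Suc (word_code w))}"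
    using coding unfolding effective_coding_def N_def by blast
  obtain pf where pf: "\<And>c T \<theta>. c \<in> D \<Longrightarrow> group_table T \<Longrightarrow> \<theta> \<in> hom G (table_group T) \<Longrightarrow>
      run pf [c, table_code T, list_encode (map \<theta> gs)] = Some (set_encode (\<theta> ` \<nu> c))"
    using images unfolding finite_computable_class_def by blast
  define P where "P x \<longleftrightarrow> (\<exists>k s. run pl [fst x, k] = Some (Suc (enc s)) \<and>
      equivclp (word_move N (set Rl) a b t (fst (snd x))) (snd (snd x)) s)"
    for x :: "nat \<times> nat list list \<times> nat list"
  define M where "M x \<longleftrightarrow> (\<exists>T as fs B v. refutation N Rl pf a b t (fst x) (fst (snd x)) (snd (snd x)) T as fs B v)"
    for x :: "nat \<times> nat list list \<times> nat list"
  have "semidecidable P"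
    unfolding P_def by (intro semidecidable_intros semidecidable_equivclp_word_move computable_intros)
  moreover have "semidecidable M"
    unfolding M_def by (rule semidecidable_refutable)
  ultimately obtain q where q: "\<And>x. M x \<longleftrightarrow> \<not> P x \<Longrightarrow> run q [enc x] = Some (if P x then 1 else 0)"
    by (rule decide_by_complementary_searches) blast
  let ?q = "Comp q [Comp pair_prog [Proj 0, Comp pair_prog [Proj 1, Proj 2]]]"
  have "run ?q [c, tuple_code ws, word_code w] = Some (if Q (\<nu> c) \<phi> (word_val G gs w) then 1 else 0)"
    if c: "c \<in> D" and rep: "represents_auto G gs ws \<phi>" and w: "w \<in> words N" for c ws \<phi> w
  proof -
    let ?x = "(c, map code_word ws, code_word w)"
    have \<phi>: "\<phi> \<in> auto G" and ws: "set ws \<subseteq> words N" "map (word_val G gs) ws = map \<phi> gs"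
      using rep by (simp_all add: represents_auto_def N_def)
    interpret presented_endo G N "letter G gs" "set Rl" \<phi> "map code_word ws"
    proof unfold_locales
      show "\<phi> \<in> hom G G" using \<phi> by (simp add: auto_def)
      fix i assume i: "i < N"
      have len: "length ws = N" using ws(2) N_def by (metis length_map)
      then have nth: "nth_default [] (map code_word ws) i = code_word (ws ! i)"
        using i by (simp add: nth_default_def)
      have "word_val G gs (ws ! i) = \<phi> (gs ! i)"
        using ws(2) i len N_def by (metis nth_map)
      moreover have "ws ! i \<in> words N" using ws(1) i len by (metis nth_mem subsetD)
      ultimately show "nth_default [] (map code_word ws) i \<in> nat_words N \<and>
          val (nth_default [] (map code_word ws) i) = \<phi> (letter G gs (2 * i))"
        by (simp add: nth word_val_eq letter_def)
    qed
    have w': "code_word w \<in> nat_words N" using w by simp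
    have K: "\<nu> c \<in> C" "\<nu> c \<subseteq> carrier G" using c coding C by (auto simp: effective_coding_def)
    have P: "P ?x \<longleftrightarrow> (\<exists>s \<in> \<nu> c. equivclp (move G a b t \<phi>) (val (code_word w)) s)"
    proof
      assume "P ?x"
      then obtain k s where s: "run pl [c, k] = Some (Suc (enc s))"
        "equivclp (word_move N (set Rl) a b t (map code_word ws)) (code_word w) s"
        by (auto simp: P_def)
      then obtain u where u: "u \<in> words N" "enc s = word_code u"
        using listing(1)[OF c, of k] by auto
      then have "s = code_word u" by (simp add: word_code_eq)
      moreover have "word_val G gs u \<in> \<nu> c" using listing(2)[OF c] u s(1) by auto
      ultimately show "\<exists>s \<in> \<nu> c. equivclp (move G a b t \<phi>) (val (code_word w)) s"
        using s(2) u(1) equivclp_word_move[OF w', of "code_word u"]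
        by (intro bexI[of _ "word_val G gs u"]) (simp_all add: word_val_eq)
    next
      assume "\<exists>s \<in> \<nu> c. equivclp (move G a b t \<phi>) (val (code_word w)) s"
      then obtain s where s: "s \<in> \<nu> c" "equivclp (move G a b t \<phi>) (val (code_word w)) s" by blast
      then obtain u k where u: "s = word_val G gs u" "u \<in> words N" "run pl [c, k] = Some (Suc (word_code u))"
        using listing(2)[OF c] by auto
      then have "equivclp (word_move N (set Rl) a b t (map code_word ws)) (code_word w) (code_word u)"
        using s(2) equivclp_word_move[OF w', of "code_word u"] by (simp add: word_val_eq)
      with u(3) show "P ?x" unfolding P_def fst_conv snd_conv word_code_eq by blast
    qed
    have "computes_images pf c (\<nu> c)"
      unfolding computes_images_def
    proof (intro allI impI)
      fix T \<theta> assume T: "group_table T" "\<theta> \<in> hom G (table_group T)"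
      have "map (\<lambda>i. \<theta> (letter G gs (i + i))) [0..<N] = map \<theta> gs"
        by (rule nth_equalityI) (simp_all add: N_def letter_def mult_2[symmetric])
      then show "run pf [c, enc T, enc (map (\<lambda>i. \<theta> (letter G gs (i + i))) [0..<N])] = Some (set_encode (\<theta> ` \<nu> c))"
        using pf[OF c T] by (simp only: table_code_eq enc_nat_list)
    qed
    then have "M ?x \<longleftrightarrow> \<not> P ?x"
      unfolding P M_def fst_conv snd_conv
      using refutation_sound[of Rl pf a b t c "code_word w" _ _ _ _ _ "\<nu> c"]
        refutation_complete[OF auto_facts(5)[OF \<phi>] sep[rule_format, OF K(1) \<phi>] refl _ K(2) w']
        K w' by blast
    then have "run q [enc ?x] = Some (if P ?x then 1 else 0)" by (rule q)
    moreover have "run ?q [c, tuple_code ws, word_code w] = run q [enc ?x]"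
      by (simp add: run_pair_prog tuple_code_eq word_code_eq enc_Pair)
    moreover have "Q (\<nu> c) \<phi> (word_val G gs w) \<longleftrightarrow> P ?x"
      unfolding P using Q[OF K(2) \<phi>] eval_word_closed[OF w'] by (simp add: word_val_eq)
    ultimately show ?thesis by simp
  qed
  then show ?thesis unfolding decidable_problem_def N_def by blast
qed

theorem corollary3p3:
  fixes G :: "('a, 'b) monoid_scheme"
    and gs :: "'a list" and R :: "word set"
    and C :: "'a set set" and D :: "nat set" and \<nu> :: "nat \<Rightarrow> 'a set"
  assumes "finite_presentation G gs R"
    and "C \<subseteq> Pow (carrier G)"
    and "effective_coding G gs D \<nu> C"
    and "finite_computable_class G gs D \<nu>"
  shows "(twisted_conjugacy_separable G C \<longrightarrow> twisted_conjugacy_problem_decidable G gs D \<nu>) \<and>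
         (Brinkmann_separable G C \<longrightarrow> Brinkmann_problem_decidable G gs D \<nu>) \<and>
         (Brinkmann_conjugacy_separable G C \<longrightarrow> Brinkmann_conjugacy_problem_decidable G gs D \<nu>)"
proof -
  interpret group G using assms(1) by (simp add: finite_presentation_def)
  have C: "K \<subseteq> carrier G" if "K \<in> C" for K using assms(2) that by blast
  note decide = saturation_problem_decidable[OF assms]
  show ?thesis
  proof (intro conjI impI)
    assume "twisted_conjugacy_separable G C"
    then have "\<forall>K \<in> C. \<forall>\<phi> \<in> auto G. separable G (saturation (move G False True True \<phi>) K)"
      using TCC_saturation C by (simp add: twisted_conjugacy_separable_def)
    then show "twisted_conjugacy_problem_decidable G gs D \<nu>"
      unfolding twisted_conjugacy_problem_decidable_def
      by (rule decide) (auto simp: twisted_conj_iff auto_facts)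
  next
    assume "Brinkmann_separable G C"
    then have "\<forall>K \<in> C. \<forall>\<phi> \<in> auto G. separable G (saturation (move G True False False \<phi>) K)"
      using auto_orbit_saturation C by (simp add: Brinkmann_separable_def)
    then show "Brinkmann_problem_decidable G gs D \<nu>"
      unfolding Brinkmann_problem_decidable_def
      by (rule decide) (auto simp: orbit_iff)
  next
    assume "Brinkmann_conjugacy_separable G C"
    then have "\<forall>K \<in> C. \<forall>\<phi> \<in> auto G. separable G (saturation (move G True True False \<phi>) K)"
      using BCC_saturation C by (simp add: Brinkmann_conjugacy_separable_def)
    then show "Brinkmann_conjugacy_problem_decidable G gs D \<nu>"
      unfolding Brinkmann_conjugacy_problem_decidable_def
      by (rule decide) (auto simp: conj_orbit_iff)
  qed
qed

end
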